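(* Let $H$ be a real separable Hilbert space, $(T_t)_{t\ge 0}$ a strongly continuous semigroup of linear operators on $H$ with dual $(T_t^* )_{t\ge 0}$, and let $(\mu_t)_{t\ge 0}$ be an SC-semigroup associated with $(T_t)_{t\ge0}$, where $\mu_t$ has the decomposition $$\hat\mu_t(a)=\exp\Big\{i\langle b_t,a\rangle-\tfrac12\langle R_ta,a\rangle+\int_{H^\circ}K(x,a)\,M_t(dx)\Big\},\qquad a\in H .$$ Then there is a family $(U_s)_{s>0}$ of nuclear operators on $H$ satisfying $U_{s+t}=T_tU_sT_t^*$ for all $s,t>0$ and $$\int_0^t \mathrm{Tr}\,U_s\,ds<\infty,\qquad t\ge 0,$$ such that $$\langle R_ta,a\rangle=\int_0^t\langle U_sa,a\rangle\,ds,\qquad t\ge 0,\ a\in H .$$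
   Context: A family $(\mu_t)_{t\ge0}$ of Borel probability measures on $H$ is a skew convolution semigroup (SC-semigroup) associated with $(T_t)_{t\ge0}$ if $\mu_{r+t}=(T_t\mu_r)*\mu_t$ for all $r,t\ge0$, where $T_t\mu_r$ is the image (pushforward) of $\mu_r$ under $T_t$ and $*$ is convolution. $\hat\mu(a)=\int_H e^{i\langle x,a\rangle}\mu(dx)$ denotes the characteristic functional. It is known that each $\mu_t$ in an SC-semigroup is infinitely divisible, and hence its characteristic functional has the displayed decomposition with a uniquely determined triple $(b_t,R_t,M_t)$: $b_t\in H$; $R_t$ is a symmetric, positive-definite (i.e. $\langle R_ta,a\rangle\ge 0$ for all $a$), nuclear (trace class) operator on $H$; $M_t$ is a $\sigma$-finite measure (Lévy measure) on $H^\circ:=H\setminus\{0\}$ with $\int_{H^\circ}(1\wedge\|x\|^2)M_t(dx)<\infty$; and $K(x,a):=e^{i\langle x,a\rangle}-1-i\langle x,a\rangle\chi_{[0,1]}(\|x\|)$, with $\chi_{[0,1]}$ the indicator function of $[0,1]$. *)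

theory Defs
  imports "HOL-Probability.Probability"
begin

section \<open>Operators on a Hilbert space\<close>

text \<open>
  A real separable Hilbert space is a type of sort
  \<open>{real_inner, complete_space, second_countable_topology}\<close>.
\<close>

definition strongly_continuous_semigroup :: "(real \<Rightarrow> 'a::real_normed_vector \<Rightarrow> 'a) \<Rightarrow> bool" where
  "strongly_continuous_semigroup T \<longleftrightarrow>
     (\<forall>t\<ge>0. bounded_linear (T t)) \<and>
     T 0 = id \<and>
     (\<forall>s\<ge>0. \<forall>t\<ge>0. T (s + t) = T s \<circ> T t) \<and>
     (\<forall>x. continuous_on {0..} (\<lambda>t. T t x))"

definition nuclear_operator :: "('a::real_inner \<Rightarrow> 'a) \<Rightarrow> bool" where
  "nuclear_operator A \<longleftrightarrow>
     bounded_linear A \<and>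
     (\<exists>(x :: nat \<Rightarrow> 'a) (y :: nat \<Rightarrow> 'a).
        summable (\<lambda>n. norm (x n) * norm (y n)) \<and>
        (\<forall>a. (\<lambda>n. (a \<bullet> x n) *\<^sub>R y n) sums A a))"

definition orthonormal_basis :: "'a::real_inner set \<Rightarrow> bool" where
  "orthonormal_basis B \<longleftrightarrow>
     pairwise orthogonal B \<and> (\<forall>e\<in>B. norm e = 1) \<and> closure (span B) = UNIV"

text \<open>
  On a Hilbert space an orthonormal basis exists, and for a nuclear operator the sum below
  converges absolutely to a value that does not depend on the basis chosen.
\<close>

definition operator_trace :: "('a::real_inner \<Rightarrow> 'a) \<Rightarrow> real" where
  "operator_trace A = (\<Sum>\<^sub>\<infinity>e\<in>(SOME B. orthonormal_basis B). A e \<bullet> e)"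

definition symmetric_operator :: "('a::real_inner \<Rightarrow> 'a) \<Rightarrow> bool" where
  "symmetric_operator A \<longleftrightarrow> (\<forall>a b. A a \<bullet> b = a \<bullet> A b)"

definition positive_operator :: "('a::real_inner \<Rightarrow> 'a) \<Rightarrow> bool" where
  "positive_operator A \<longleftrightarrow> (\<forall>a. A a \<bullet> a \<ge> 0)"


section \<open>Skew convolution semigroups\<close>

text \<open>The library's \<^const>\<open>convolution\<close>, with the sort constraint relaxed from Euclidean spaces.\<close>

definition conv :: "'a::{real_normed_vector, second_countable_topology} measure \<Rightarrow> 'a measure \<Rightarrow> 'a measure"
  where "conv M N = distr (M \<Otimes>\<^sub>M N) borel (\<lambda>(x, y). x + y)"

definition SC_semigroup ::
  "(real \<Rightarrow> 'a \<Rightarrow> 'a) \<Rightarrow> (real \<Rightarrow> 'a::{real_normed_vector, second_countable_topology} measure) \<Rightarrow> bool"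
  where
  "SC_semigroup T \<mu> \<longleftrightarrow>
     (\<forall>t\<ge>0. prob_space (\<mu> t) \<and> sets (\<mu> t) = sets borel) \<and>
     (\<forall>r\<ge>0. \<forall>t\<ge>0. \<mu> (r + t) = conv (distr (\<mu> r) borel (T t)) (\<mu> t))"


section \<open>Characteristic functionals\<close>

definition char_functional :: "'a::real_inner measure \<Rightarrow> 'a \<Rightarrow> complex" where
  "char_functional \<mu> a = (CLINT x|\<mu>. iexp (x \<bullet> a))"

definition levy_kernel :: "'a::real_inner \<Rightarrow> 'a \<Rightarrow> complex" where
  "levy_kernel x a =
     iexp (x \<bullet> a) - 1 - \<i> * complex_of_real (x \<bullet> a) * indicator {0..1} (norm x)"

text \<open>A Levy measure lives on the punctured space, so \<open>space M = - {0}\<close>.\<close>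

definition levy_measure :: "'a::real_inner measure \<Rightarrow> bool" where
  "levy_measure M \<longleftrightarrow>
     sets M = sets (restrict_space borel (- {0})) \<and>
     sigma_finite_measure M \<and>
     (\<integral>\<^sup>+x. ennreal (min 1 ((norm x)\<^sup>2)) \<partial>M) < \<infinity>"

definition has_levy_khintchine_triple ::
  "'a::real_inner measure \<Rightarrow> 'a \<Rightarrow> ('a \<Rightarrow> 'a) \<Rightarrow> 'a measure \<Rightarrow> bool" where
  "has_levy_khintchine_triple \<mu> b R M \<longleftrightarrow>
     nuclear_operator R \<and> symmetric_operator R \<and> positive_operator R \<and>
     levy_measure M \<and>
     (\<forall>a. char_functional \<mu> a =
        exp (\<i> * complex_of_real (b \<bullet> a) - complex_of_real (R a \<bullet> a) / 2
             + (CLINT x|M. levy_kernel x a)))"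

end

(*
  The Gaussian parts form a cocycle R_(r+t) = T_t R_r T_t^* + R_t, because R_t is read off from the
  growth of -ln |mu_t^| along rays. Positivity makes t |-> R_t increasing; transporting the increment
  over [kh, (k+1)h] by T_(s-kh) and summing over k bounds N Tr(R_(s+h) - R_s) by a constant times
  Tr R_eps, where N is about eps/h. So R is Lipschitz away from 0 in trace, and the difference
  quotients of R at s have a weak limit point U_s of finite trace. Dominated convergence gives
  <R_t a, a> - <R_s a, a> as the integral of <U_s S_r a, S_r a> with S_r = T_(r-s)^*, r in [s,t]. The
  integrand is continuous, hence U_s is the right derivative of R at s; this makes U_s unique and
  yields U_(s+t) = T_t U_s T_t^*. Finally R has no jump at 0, since the cocycle identity would
  repeat it at 1.
*)
theory Submission
  imports Defs
begin

section \<open>Orthonormal sequences\<close>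

text \<open>No regularity of t |-> mu_t is assumed; monotonicity, finite traces and strong
  continuity of T are the only sources of it. Transport by T runs forward in time, so an increment
  at s is comparable only with increments starting earlier, and the Lipschitz constant is of order
  Tr R_eps / eps, which gives no integrable bound near 0. Integrability of Tr U_s down to 0 comes
  instead from integrating each nonnegative <U_s a, a> exactly and summing over a basis. Continuity
  of r |-> <A S_r a, S_r a> also rests on the trace: r |-> <S_r a, x> is continuous because S_r is
  adjoint to T_r, and finite trace writes A as a sum of rank-one terms <., x_n> x_n with summable
  |x_n|^2, so the form is a uniform limit. The same factorization bounds the trace of F A F^* and
  yields nuclearity of U_s. Operators are compared through quadratic forms; polarisation restores
  the operator identity at the end. In passing from mu_t to R_t the modulus removes drift and
  compensator, and the jump integral at n a is o(n^2).\<close>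

lemma adjoint_inner:
  assumes "\<exists>g. \<forall>x y. f x \<bullet> y = x \<bullet> g y"
  shows "f x \<bullet> y = x \<bullet> adjoint f y"
  using someI_ex[OF assms] unfolding adjoint_def by (elim allE)

text \<open>The sort \<open>{real_inner, complete_space}\<close> does not entail the class \<open>banach\<close>, so the library
  criteria for summability are not available as they stand.\<close>

lemma summable_if_partial_sums_Cauchy:
  fixes f :: "nat \<Rightarrow> 'a::{real_normed_vector, complete_space}"
  assumes "\<And>\<epsilon>. \<epsilon> > 0 \<Longrightarrow> \<exists>N. \<forall>m\<ge>N. \<forall>n. norm (\<Sum>k=m..<n. f k) < \<epsilon>"
  shows "summable f"
proof -
  have "Cauchy (\<lambda>n. \<Sum>k<n. f k)"
  proof (rule CauchyI')
    fix \<epsilon> :: real assume "\<epsilon> > 0"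
    then obtain N where N: "\<And>m n. m \<ge> N \<Longrightarrow> norm (\<Sum>k=m..<n. f k) < \<epsilon>" using assms by blast
    have "dist (\<Sum>k<m. f k) (\<Sum>k<n. f k) < \<epsilon>" if "m \<ge> N" "m < n" for m n
    proof -
      have "(\<Sum>k<n. f k) - (\<Sum>k<m. f k) = (\<Sum>k=m..<n. f k)"
        using sum_diff_nat_ivl[of 0 m n f] \<open>m < n\<close> by (simp add: atLeast0LessThan)
      then show ?thesis using N[OF \<open>m \<ge> N\<close>, of n]
        by (metis dist_norm norm_minus_commute)
    qed
    then show "\<exists>M. \<forall>m\<ge>M. \<forall>n>m. dist (\<Sum>k<m. f k) (\<Sum>k<n. f k) < \<epsilon>" by blast
  qed
  then show ?thesis by (simp add: Cauchy_convergent_iff summable_iff_convergent)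
qed

lemma summable_of_norm_le:
  fixes f :: "nat \<Rightarrow> 'a::{real_normed_vector, complete_space}"
  assumes "summable g" and "\<And>n. norm (f n) \<le> g n"
  shows "summable f"
proof (rule summable_if_partial_sums_Cauchy)
  fix \<epsilon> :: real assume "\<epsilon> > 0"
  then obtain N where N: "\<And>m n. m \<ge> N \<Longrightarrow> norm (\<Sum>k=m..<n. g k) < \<epsilon>"
    using assms(1) unfolding summable_Cauchy by blast
  have "norm (\<Sum>k=m..<n. f k) < \<epsilon>" if "m \<ge> N" for m n
    using sum_norm_le[of "{m..<n}" f g] assms(2) N[OF that, of n] by simp
  then show "\<exists>N. \<forall>m\<ge>N. \<forall>n. norm (\<Sum>k=m..<n. f k) < \<epsilon>" by blast
qed

locale onb_sequence =
  fixes e :: "nat \<Rightarrow> 'a::{real_inner, complete_space}"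
  assumes orthogonal: "i \<noteq> j \<Longrightarrow> e i \<bullet> e j = 0"
    and normalized: "e i \<bullet> e i = 0 \<or> e i \<bullet> e i = 1"
    and dense: "closure (span (range e)) = UNIV"
begin

definition proj :: "nat \<Rightarrow> 'a \<Rightarrow> 'a" where
  "proj n x = (\<Sum>k<n. (x \<bullet> e k) *\<^sub>R e k)"

lemma inner_e: "e i \<bullet> e j = (if i = j \<and> e i \<noteq> 0 then 1 else 0)"
  using orthogonal[of i j] normalized[of i] by auto

text \<open>If \<open>e k\<close> is zero both sides vanish, so zero vectors never have to be
  separated from unit vectors inside sums.\<close>

lemma coeff_mult_inner_e: "(x \<bullet> e k) * (e k \<bullet> e k) = x \<bullet> e k"
  using normalized[of k] by auto

lemma inner_sum_e: "(\<Sum>k<n. c k *\<^sub>R e k) \<bullet> e j = (if j < n then c j * (e j \<bullet> e j) else 0)"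
proof -
  have "(\<Sum>k<n. c k *\<^sub>R e k) \<bullet> e j = (\<Sum>k<n. if k = j then c j * (e j \<bullet> e j) else 0)"
    unfolding inner_sum_left by (intro sum.cong refl) (auto simp: orthogonal)
  then show ?thesis by simp
qed

lemma proj_inner: "proj n x \<bullet> y = (\<Sum>k<n. (x \<bullet> e k) * (y \<bullet> e k))"
  unfolding proj_def inner_sum_left by (simp add: inner_commute)

lemma linear_proj: "linear (proj n)"
  by (intro linearI)
     (simp_all add: proj_def inner_add_left scaleR_add_left sum.distrib scaleR_sum_right)

lemma inner_proj_proj: "proj n x \<bullet> proj n x = proj n x \<bullet> x"
proof -
  have "proj n x \<bullet> e k = x \<bullet> e k" if "k < n" for k
    unfolding proj_def inner_sum_e using that coeff_mult_inner_e by simp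
  then show ?thesis by (simp add: proj_inner)
qed

lemma norm_proj_le: "norm (proj n x) \<le> norm x"
proof -
  have "norm (proj n x) * norm (proj n x) \<le> norm (proj n x) * norm x"
    using inner_proj_proj[of n x] norm_cauchy_schwarz[of "proj n x" x]
    by (simp flip: power2_norm_eq_inner add: power2_eq_square)
  then show ?thesis by (cases "norm (proj n x) = 0") auto
qed

lemma bessel: "(\<Sum>k<n. (x \<bullet> e k)\<^sup>2) \<le> (norm x)\<^sup>2"
proof -
  have "(\<Sum>k<n. (x \<bullet> e k)\<^sup>2) = proj n x \<bullet> x"
    by (simp add: proj_inner power2_eq_square)
  also have "\<dots> \<le> norm (proj n x) * norm x" by (rule norm_cauchy_schwarz)
  also have "\<dots> \<le> norm x * norm x" by (intro mult_right_mono norm_proj_le) auto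
  finally show ?thesis by (simp add: power2_eq_square)
qed

lemma span_closed_induct:
  assumes "\<And>k. P (e k)" and "subspace {x. P x}" and "closed {x. P x}"
  shows "P x"
proof -
  have "span (range e) \<subseteq> {x. P x}" using assms by (intro span_minimal) auto
  then have "closure (span (range e)) \<subseteq> {x. P x}" using assms(3) by (rule closure_minimal)
  then show ?thesis using dense by auto
qed

lemma bounded_linear_eqI:
  fixes f g :: "'a \<Rightarrow> 'b::real_normed_vector"
  assumes f: "bounded_linear f" and g: "bounded_linear g" and eq: "\<And>k. f (e k) = g (e k)"
  shows "f x = g x"
proof (rule span_closed_induct[where P = "\<lambda>x. f x = g x", OF eq])
  show "subspace {x. f x = g x}"
    using f g by (auto simp: subspace_def bounded_linear.linear linear_add linear_scale linear_0)
  show "closed {x. f x = g x}"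
    using f g by (intro closed_Collect_eq linear_continuous_on)
qed

text \<open>The uniform bound makes the family equicontinuous, so the set of points of convergence
  is closed; linearity makes it a subspace.\<close>

lemma convergent_of_dense:
  fixes f :: "nat \<Rightarrow> 'a \<Rightarrow> 'b::{real_normed_vector, complete_space}"
  assumes lin: "\<And>n. linear (f n)" and bd: "\<And>n x. norm (f n x) \<le> C * norm x"
    and conv: "\<And>k. convergent (\<lambda>n. f n (e k))"
  shows "convergent (\<lambda>n. f n x)"
proof (rule span_closed_induct[where P = "\<lambda>x. convergent (\<lambda>n. f n x)", OF conv])
  show "subspace {x. convergent (\<lambda>n. f n x)}"
    using lin by (auto simp: subspace_def linear_add linear_scale linear_0
        intro!: convergent_add convergent_const
         bounded_linear.convergent[OF bounded_linear_scaleR_right])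
  show "closed {x. convergent (\<lambda>n. f n x)}"
    unfolding closed_sequential_limits
  proof (intro allI impI, elim conjE)
    fix y l assume y: "\<forall>n. y n \<in> {x. convergent (\<lambda>n. f n x)}" and yl: "y \<longlonglongrightarrow> l"
    have "Cauchy (\<lambda>n. f n l)"
    proof (rule metric_CauchyI)
      fix \<epsilon> :: real assume \<epsilon>: "\<epsilon> > 0"
      \<comment> \<open>The hypothesis admits \<open>C\<close> zero or negative;
        \<open>\<bar>C\<bar> + 1\<close> keeps the denominator positive. Three errors of at most
        \<epsilon>/4 stay below \<epsilon>.\<close>
      define \<delta> where "\<delta> = \<epsilon> / (4 * (\<bar>C\<bar> + 1))"
      have \<delta>: "\<delta> > 0" using \<epsilon> by (simp add: \<delta>_def)
      then obtain k where k: "dist (y k) l < \<delta>"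
        using yl unfolding LIMSEQ_iff_nz lim_sequentially by blast
      have close: "norm (f n l - f n (y k)) \<le> \<epsilon> / 4" for n
      proof -
        have "norm (f n l - f n (y k)) = norm (f n (l - y k))"
          using lin by (simp add: linear_diff)
        also have "\<dots> \<le> C * norm (l - y k)" by (rule bd)
        also have "\<dots> \<le> (\<bar>C\<bar> + 1) * \<delta>"
          using k by (intro mult_mono) (auto simp: dist_norm norm_minus_commute)
        also have "\<dots> = \<epsilon> / 4" by (simp add: \<delta>_def field_simps)
        finally show ?thesis .
      qed
      have "Cauchy (\<lambda>n. f n (y k))" using y convergent_Cauchy by blast
      then obtain N where N: "\<And>m n. m \<ge> N \<Longrightarrow> n \<ge> N \<Longrightarrow> dist (f m (y k)) (f n (y k)) < \<epsilon> / 4"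
        using \<epsilon> unfolding Cauchy_def by (metis divide_pos_pos zero_less_numeral)
      have "dist (f m l) (f n l) < \<epsilon>" if "m \<ge> N" "n \<ge> N" for m n
      proof -
        have "f m l - f n l = (f m l - f m (y k)) + (f m (y k) - f n (y k)) - (f n l - f n (y k))"
          by simp
        also have "norm \<dots> \<le> norm (f m l - f m (y k)) + norm (f m (y k) - f n (y k))
            + norm (f n l - f n (y k))"
          by (meson add_mono_thms_linordered_semiring(3) norm_triangle_ineq norm_triangle_ineq4 order_trans)
        finally show ?thesis
          using close[of m] close[of n] N[OF that] \<epsilon> by (simp add: dist_norm)
      qed
      then show "\<exists>M. \<forall>m\<ge>M. \<forall>n\<ge>M. dist (f m l) (f n l) < \<epsilon>" by blast
    qed
    then show "l \<in> {x. convergent (\<lambda>n. f n x)}" by (simp add: Cauchy_convergent_iff)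
  qed
qed

lemma proj_e: "proj n (e k) = (if k < n then e k else 0)"
proof -
  have "proj n (e k) = (\<Sum>j<n. if j = k then e k else 0)"
    unfolding proj_def by (intro sum.cong refl) (auto simp: inner_e)
  then show ?thesis by simp
qed

text \<open>Existence of the limit comes first, by equicontinuity. The limit is then a bounded
  operator that agrees with the identity on the basis.\<close>

lemma proj_tendsto: "(\<lambda>n. proj n x) \<longlonglongrightarrow> x"
proof -
  have e: "(\<lambda>n. proj n (e k)) \<longlonglongrightarrow> e k" for k
    by (rule tendsto_eventually) (auto simp: proj_e eventually_sequentially intro!: exI[of _ "Suc k"])
  have conv: "(\<lambda>n. proj n x) \<longlonglongrightarrow> lim (\<lambda>n. proj n x)" for x
    unfolding convergent_LIMSEQ_iff[symmetric]
  proof (rule convergent_of_dense[where C = 1])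
    show "linear (proj n)" for n by (rule linear_proj)
    show "norm (proj n x) \<le> 1 * norm x" for n x using norm_proj_le by simp
    show "convergent (\<lambda>n. proj n (e k))" for k using e by (auto simp: convergent_def)
  qed
  have "lim (\<lambda>n. proj n x) = id x"
  proof (rule bounded_linear_eqI[where f = "\<lambda>x. lim (\<lambda>n. proj n x)" and g = id])
    show "bounded_linear (\<lambda>x. lim (\<lambda>n. proj n x))"
    proof (rule bounded_linear_intro[where K = 1])
      fix x y :: 'a and c :: real
      show "lim (\<lambda>n. proj n (x + y)) = lim (\<lambda>n. proj n x) + lim (\<lambda>n. proj n y)"
        using tendsto_add[OF conv[of x] conv[of y]] by (intro limI) (simp add: linear_add[OF linear_proj])
      show "lim (\<lambda>n. proj n (c *\<^sub>R x)) = c *\<^sub>R lim (\<lambda>n. proj n x)"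
        using tendsto_scaleR[OF tendsto_const conv[of x]]
        by (intro limI) (simp add: linear_scale[OF linear_proj])
      show "norm (lim (\<lambda>n. proj n x)) \<le> norm x * 1"
        using LIMSEQ_le_const2[OF tendsto_norm[OF conv[of x]]] norm_proj_le by auto
    qed
    show "bounded_linear (id :: 'a \<Rightarrow> 'a)" unfolding id_def by (rule bounded_linear_ident)
    show "lim (\<lambda>n. proj n (e k)) = id (e k)" for k using limI[OF e] by simp
  qed
  then show ?thesis using conv[of x] by simp
qed

lemma expansion: "(\<lambda>n. (x \<bullet> e n) *\<^sub>R e n) sums x"
  using proj_tendsto[of x] unfolding sums_def proj_def .

lemma parseval: "(\<lambda>n. (x \<bullet> e n)\<^sup>2) sums (norm x)\<^sup>2"
  using tendsto_inner[OF proj_tendsto[of x] tendsto_const[of x]]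
  unfolding sums_def proj_inner power2_norm_eq_inner by (simp add: power2_eq_square)

section \<open>Riesz-Fischer, Riesz representation and adjoints\<close>

lemma riesz_fischer:
  assumes "summable (\<lambda>n. (c n)\<^sup>2)"
  shows "summable (\<lambda>n. c n *\<^sub>R e n)"
proof -
  \<comment> \<open>An inequality and not an equality, since some \<open>e j\<close> may be
    zero.\<close>
  have pyth: "(norm (\<Sum>k=m..<n. c k *\<^sub>R e k))\<^sup>2 \<le> (\<Sum>k=m..<n. (c k)\<^sup>2)" for m n
  proof -
    have "(norm (\<Sum>k=m..<n. c k *\<^sub>R e k))\<^sup>2
        = (\<Sum>j=m..<n. \<Sum>k=m..<n. c j * (c k * (e j \<bullet> e k)))"
      by (simp add: power2_norm_eq_inner inner_sum_left inner_sum_right sum_distrib_left)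
         (subst sum.swap, simp add: mult_ac)
    also have "\<dots> = (\<Sum>j=m..<n. \<Sum>k=m..<n. if k = j then (c j)\<^sup>2 * (e j \<bullet> e j) else 0)"
      by (intro sum.cong refl) (auto simp: orthogonal power2_eq_square)
    also have "\<dots> = (\<Sum>j=m..<n. (c j)\<^sup>2 * (e j \<bullet> e j))" by (simp add: sum.delta)
    also have "\<dots> \<le> (\<Sum>j=m..<n. (c j)\<^sup>2)"
    proof (rule sum_mono)
      fix j show "(c j)\<^sup>2 * (e j \<bullet> e j) \<le> (c j)\<^sup>2"
        using normalized[of j] by auto
    qed
    finally show ?thesis .
  qed
  show ?thesis
  proof (rule summable_if_partial_sums_Cauchy)
    fix \<epsilon> :: real assume \<epsilon>: "\<epsilon> > 0"
    then obtain N where N: "\<And>m n. m \<ge> N \<Longrightarrow> norm (\<Sum>k=m..<n. (c k)\<^sup>2) < \<epsilon>\<^sup>2"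
      using assms[unfolded summable_Cauchy] by (meson zero_less_power)
    have "norm (\<Sum>k=m..<n. c k *\<^sub>R e k) < \<epsilon>" if "m \<ge> N" for m n
    proof -
      have "(norm (\<Sum>k=m..<n. c k *\<^sub>R e k))\<^sup>2 < \<epsilon>\<^sup>2"
        using pyth[of m n] N[OF that, of n] by (auto simp: sum_nonneg)
      then show ?thesis using \<epsilon> power2_less_imp_less by force
    qed
    then show "\<exists>N. \<forall>m\<ge>N. \<forall>n. norm (\<Sum>k=m..<n. c k *\<^sub>R e k) < \<epsilon>" by blast
  qed
qed

text \<open>The representing vector is the sum of \<open>f (e n) *\<^sub>R e n\<close>. Its
  coefficients are square summable because f tested on a partial sum z gives |z|^2 = f z <= K |z|,
  hence |z| <= K.\<close>

lemma riesz_representation: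
  fixes f :: "'a \<Rightarrow> real"
  assumes "bounded_linear f"
  shows "\<exists>y. \<forall>x. f x = x \<bullet> y"
proof -
  interpret f: bounded_linear f by fact
  obtain K where K: "\<And>x. norm (f x) \<le> norm x * K" "K \<ge> 0" using f.nonneg_bounded by blast
  have "(\<Sum>k<n. (f (e k))\<^sup>2) \<le> K\<^sup>2" for n
  proof -
    define z where "z = (\<Sum>k<n. f (e k) *\<^sub>R e k)"
    have fe: "f (e k) * (e k \<bullet> e k) = f (e k)" for k
      using normalized[of k] by auto
    have zz: "(norm z)\<^sup>2 = (\<Sum>k<n. (f (e k))\<^sup>2)"
      unfolding power2_norm_eq_inner
      by (subst (2) z_def) (simp add: inner_sum_right z_def inner_sum_e fe power2_eq_square)
    have "(norm z)\<^sup>2 = f z" unfolding zz by (simp add: z_def f.sum f.scaleR power2_eq_square)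
    also have "\<dots> \<le> norm z * K" using K(1)[of z] by simp
    finally have "norm z \<le> K" using K(2) by (cases "z = 0") (auto simp: power2_eq_square)
    then show ?thesis unfolding zz[symmetric] by (intro power_mono) auto
  qed
  then have "summable (\<lambda>n. (f (e n))\<^sup>2)"
    by (intro summableI_nonneg_bounded) auto
  then have y: "(\<lambda>n. f (e n) *\<^sub>R e n) sums (\<Sum>n. f (e n) *\<^sub>R e n)"
    by (rule summable_sums[OF riesz_fischer])
  have "f x = x \<bullet> (\<Sum>n. f (e n) *\<^sub>R e n)" for x
  proof -
    have "(\<lambda>n. (x \<bullet> e n) *\<^sub>R f (e n)) sums f x"
      using f.sums[OF expansion[of x]] by (simp add: f.scaleR)
    moreover have "(\<lambda>n. f (e n) * (x \<bullet> e n)) sums (x \<bullet> (\<Sum>n. f (e n) *\<^sub>R e n))"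
      using bounded_linear.sums[OF bounded_linear_inner_right y] by simp
    ultimately show ?thesis by (simp add: sums_unique2 mult.commute)
  qed
  then show ?thesis by blast
qed

text \<open>Riesz representation in the second argument, for each fixed first argument; uniqueness
  of the representing vector makes it linear in a. Weak limits of operators are turned back into
  operators this way.\<close>

lemma operator_of_bounded_form:
  fixes \<beta> :: "'a \<Rightarrow> 'a \<Rightarrow> real"
  assumes lin: "\<And>a. linear (\<beta> a)" "\<And>b. linear (\<lambda>a. \<beta> a b)"
    and bd: "\<And>a b. \<bar>\<beta> a b\<bar> \<le> C * norm a * norm b"
  shows "\<exists>U. bounded_linear U \<and> (\<forall>a b. U a \<bullet> b = \<beta> a b)"
proof -
  have "\<exists>y. \<forall>b. \<beta> a b = b \<bullet> y" for a
  proof (rule riesz_representation, rule bounded_linear_intro[where K = "C * norm a"])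
    show "norm (\<beta> a x) \<le> norm x * (C * norm a)" for x
      using bd[of a x] by (simp add: mult_ac)
  qed (use lin(1) in \<open>auto simp: linear_add linear_scale\<close>)
  then obtain U where U: "\<And>a b. \<beta> a b = b \<bullet> U a" by metis
  have "bounded_linear U"
  proof (rule bounded_linear_intro[where K = C])
    fix x y and r :: real
    show "U (x + y) = U x + U y"
    proof (rule vector_eq_rdot[THEN iffD1], rule allI)
      show "U (x + y) \<bullet> z = (U x + U y) \<bullet> z" for z
        using linear_add[OF lin(2)[of z], of x y] by (simp add: U inner_commute inner_add)
    qed
    show "U (r *\<^sub>R x) = r *\<^sub>R U x"
    proof (rule vector_eq_rdot[THEN iffD1], rule allI)
      show "U (r *\<^sub>R x) \<bullet> z = (r *\<^sub>R U x) \<bullet> z" for z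
        using linear_scale[OF lin(2)[of z], of r x] by (simp add: U inner_commute)
    qed
    show "norm (U x) \<le> norm x * C"
    proof (cases "U x = 0")
      case True
      \<comment> \<open>The sign of \<open>C\<close> is unknown; the form bound on the diagonal
        supplies what is needed.\<close>
      have "0 \<le> C * norm x * norm x" using bd[of x x] by linarith
      then have "0 \<le> norm x * C"
        using norm_ge_zero[of x] by (cases "x = 0") (simp_all add: zero_le_mult_iff)
      with True show ?thesis by simp
    next
      case False
      have "norm (U x) * norm (U x) = \<beta> x (U x)"
        unfolding U power2_norm_eq_inner[symmetric] by (simp add: power2_eq_square)
      also have "\<dots> \<le> C * norm x * norm (U x)" using bd[of x "U x"] by linarith
      finally show ?thesis using False by (simp add: mult.commute)
    qed
  qed
  then show ?thesis using U by (auto simp: inner_commute)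
qed

text \<open>\<open>adjoint\<close> is a Hilbert choice, so its identity needs the existence of some
  adjoint; representing x |-> <f x, y> for every y provides one.\<close>

lemma adjoint_works:
  fixes f :: "'a \<Rightarrow> 'b::real_inner"
  assumes "bounded_linear f"
  shows "f x \<bullet> y = x \<bullet> adjoint f y"
proof (rule adjoint_inner)
  interpret f: bounded_linear f by fact
  have "\<exists>z. \<forall>x. f x \<bullet> y = x \<bullet> z" for y
    by (rule riesz_representation) (intro bounded_linear_compose[OF bounded_linear_inner_left] assms)
  then show "\<exists>g. \<forall>x y. f x \<bullet> y = x \<bullet> g y" by metis
qed

text \<open>Testing f at the vector \<open>adjoint f y\<close> shows that every norm bound for f
  passes to the adjoint with the same constant. The bound on the adjoint semigroup comes from
  here.\<close>

lemma bounded_linear_adjoint: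
  fixes f :: "'a \<Rightarrow> 'a"
  assumes "bounded_linear f"
  shows "bounded_linear (adjoint f)" and "\<And>C y. (\<And>x. norm (f x) \<le> C * norm x) \<Longrightarrow> norm (adjoint f y) \<le> C * norm y"
proof -
  interpret f: bounded_linear f by fact
  note a = adjoint_works[OF assms]
  have lin: "linear (adjoint f)"
  proof (rule linearI; rule vector_eq_ldot[THEN iffD1]; rule allI)
    show "x \<bullet> adjoint f (b1 + b2) = x \<bullet> (adjoint f b1 + adjoint f b2)" for x b1 b2
      using a[of x b1] a[of x b2] a[of x "b1 + b2"] by (simp add: inner_add_right)
    show "x \<bullet> adjoint f (r *\<^sub>R b1) = x \<bullet> (r *\<^sub>R adjoint f b1)" for x b1 r
      using a[of x b1] a[of x "r *\<^sub>R b1"] by simp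
  qed
  show bd: "norm (adjoint f y) \<le> C * norm y" if C: "\<And>x. norm (f x) \<le> C * norm x" for C y
  proof (cases "adjoint f y = 0")
    case True
    have "0 \<le> C * norm y" using order_trans[OF norm_ge_zero C[of y]] .
    with True show ?thesis by simp
  next
    case False
    have "norm (adjoint f y) * norm (adjoint f y) = f (adjoint f y) \<bullet> y"
      unfolding a power2_norm_eq_inner[symmetric] by (simp add: power2_eq_square)
    also have "\<dots> \<le> norm (f (adjoint f y)) * norm y" by (rule norm_cauchy_schwarz)
    also have "\<dots> \<le> C * norm (adjoint f y) * norm y" using C by (intro mult_right_mono) auto
    finally show ?thesis using False by simp
  qed
  obtain K where "\<And>x. norm (f x) \<le> norm x * K" using f.bounded by blast
  with bd[of K] lin show "bounded_linear (adjoint f)"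
    by (intro bounded_linear_intro[where K = K]) (auto simp: linear_add linear_scale mult.commute)
qed

end

section \<open>Existence and enumeration of orthonormal bases\<close>

text \<open>\<open>sgn\<close> normalizes and maps 0 to 0, so a vector that depends on its
  predecessors becomes zero and needs no separate treatment.\<close>

function gram_schmidt :: "(nat \<Rightarrow> 'a::real_inner) \<Rightarrow> nat \<Rightarrow> 'a" where
  "gram_schmidt d n = sgn (d n - (\<Sum>k<n. (d n \<bullet> gram_schmidt d k) *\<^sub>R gram_schmidt d k))"
  by auto
termination by (relation "inv_image less_than snd") auto

declare gram_schmidt.simps [simp del]

text \<open>Gram-Schmidt is applied to an enumeration of a countable dense set, and the nonzero
  outputs are kept.\<close>

lemma orthonormal_basis_exists:
  "\<exists>B :: 'a::{real_inner, second_countable_topology} set. orthonormal_basis B"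
proof -
  obtain D :: "'a set" where D: "countable D" "\<And>X. open X \<Longrightarrow> X \<noteq> {} \<Longrightarrow> \<exists>d\<in>D. d \<in> X"
    using countable_dense_setE by blast
  have "D \<noteq> {}" using D(2)[of UNIV] by auto
  define d where "d = from_nat_into D"
  have range_d: "range d = D" unfolding d_def using D(1) \<open>D \<noteq> {}\<close> by simp
  define g where "g = gram_schmidt d"
  define v where "v n = d n - (\<Sum>k<n. (d n \<bullet> g k) *\<^sub>R g k)" for n
  have g: "g n = sgn (v n)" for n
    unfolding g_def v_def by (subst gram_schmidt.simps) simp
  have unit: "g n \<bullet> g n = (if g n = 0 then 0 else 1)" for n
    by (simp add: g norm_sgn sgn_zero_iff flip: power2_norm_eq_inner)
  have orth: "i < n \<Longrightarrow> g n \<bullet> g i = 0" for n i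
  proof (induction n arbitrary: i rule: less_induct)
    case (less n)
    have *: "g k \<bullet> g i = (if k = i then g i \<bullet> g i else 0)" if "k < n" for k
      using less.IH[of k i] less.IH[of i k] less.prems that by (cases k i rule: linorder_cases) (auto simp: inner_commute)
    have "v n \<bullet> g i = d n \<bullet> g i - (\<Sum>k<n. (d n \<bullet> g k) * (g k \<bullet> g i))"
      by (simp add: v_def inner_diff_left inner_sum_left)
    also have "(\<Sum>k<n. (d n \<bullet> g k) * (g k \<bullet> g i)) = (\<Sum>k<n. if k = i then (d n \<bullet> g i) * (g i \<bullet> g i) else 0)"
      by (intro sum.cong refl, subst *) simp_all
    also have "\<dots> = d n \<bullet> g i" using less.prems unit[of i] by simp
    finally have "v n \<bullet> g i = 0" by simp
    then show ?case by (simp add: g[of n] sgn_div_norm)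
  qed
  define B where "B = range g - {0}"
  have in_span: "g k \<in> span B" for k
    by (cases "g k = 0") (auto simp: B_def span_base span_zero)
  have "d n \<in> span B" for n
  proof -
    have "v n = norm (v n) *\<^sub>R g n" by (cases "v n = 0") (simp_all add: g sgn_div_norm)
    then have "v n \<in> span B" using span_scale[OF in_span[of n]] by metis
    then have "v n + (\<Sum>k<n. (d n \<bullet> g k) *\<^sub>R g k) \<in> span B"
      by (intro span_add span_sum span_scale in_span)
    then show ?thesis by (simp add: v_def)
  qed
  then have sub: "D \<subseteq> span B" using range_d by auto
  have "closure D = UNIV"
  proof (rule ccontr)
    assume "closure D \<noteq> UNIV"
    then obtain d where "d \<in> D" "d \<in> - closure D" using D(2)[of "- closure D"] by auto
    then show False using closure_subset by auto
  qed
  then have "closure (span B) = UNIV" using closure_mono[OF sub] by auto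
  moreover have "pairwise orthogonal B"
  proof (rule pairwiseI)
    fix x y assume "x \<in> B" "y \<in> B" "x \<noteq> y"
    then obtain i j where "x = g i" "y = g j" "i \<noteq> j" by (auto simp: B_def)
    then show "orthogonal x y" using orth[of i j] orth[of j i]
      by (cases i j rule: linorder_cases) (auto simp: orthogonal_def inner_commute)
  qed
  moreover have "norm x = 1" if "x \<in> B" for x
    using that by (auto simp: B_def g norm_sgn)
  ultimately show ?thesis unfolding orthonormal_basis_def by blast
qed

text \<open>Distinct basis vectors are at distance sqrt 2, so points of a countable dense set chosen
  within 1/2 of them are distinct.\<close>

lemma countable_orthonormal_basis:
  fixes B :: "'a::{real_inner, second_countable_topology} set"
  assumes "orthonormal_basis B"
  shows "countable B"
proof -
  obtain D :: "'a set" where D: "countable D" "\<And>X. open X \<Longrightarrow> X \<noteq> {} \<Longrightarrow> \<exists>d\<in>D. d \<in> X"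
    using countable_dense_setE by blast
  have "\<exists>d\<in>D. dist x d < 1/2" for x :: 'a using D(2)[of "ball x (1/2)"] by auto
  then obtain p where p: "\<And>x. p x \<in> D" "\<And>x. dist x (p x) < 1/2" by metis
  have "inj_on p B"
  proof (rule inj_onI, rule ccontr)
    fix x y assume xy: "x \<in> B" "y \<in> B" "p x = p y" "x \<noteq> y"
    then have o: "x \<bullet> y = 0" and n: "norm x = 1" "norm y = 1"
      using assms by (auto simp: orthonormal_basis_def pairwise_def orthogonal_def)
    have "(norm (x - y))\<^sup>2 = (norm x)\<^sup>2 + (norm y)\<^sup>2 - 2 * (x \<bullet> y)"
      by (simp add: power2_norm_eq_inner inner_diff inner_commute)
    then have "(norm (x - y))\<^sup>2 = 2" using o n by simp
    moreover have "dist x y < 1"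
      using p(2)[of x] p(2)[of y] xy(3) dist_triangle_half_l[of x "p x" 1 y] by (simp add: dist_commute)
    then have "(norm (x - y))\<^sup>2 < 1\<^sup>2"
      unfolding dist_norm by (intro power_strict_mono) auto
    ultimately show False by simp
  qed
  moreover have "countable (p ` B)" using p(1) D(1) by (meson countable_subset image_subset_iff)
  ultimately show ?thesis by (rule countable_image_inj_on[rotated])
qed

text \<open>A finite basis is padded with zeros, which is why \<^locale>\<open>onb_sequence\<close> admits zero vectors.\<close>

lemma orthonormal_basis_sequence:
  fixes B :: "'a::{real_inner, complete_space, second_countable_topology} set"
  assumes B: "orthonormal_basis B"
  shows "\<exists>e. onb_sequence e \<and> (\<forall>g :: 'a \<Rightarrow> real. g 0 = 0 \<longrightarrow> (\<forall>n. g (e n) \<ge> 0) \<longrightarrow>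
           summable (\<lambda>n. g (e n)) \<longrightarrow> infsum g B = (\<Sum>n. g (e n)))"
proof -
  have cB: "countable B" by (rule countable_orthonormal_basis[OF B])
  define I where "I = to_nat_on B ` B"
  have inj: "inj_on (to_nat_on B) B" by (rule inj_on_to_nat_on[OF cB])
  define e where "e n = (if n \<in> I then the_inv_into B (to_nat_on B) n else 0)" for n
  have e_nat: "e (to_nat_on B x) = x" if "x \<in> B" for x
    using that inj by (simp add: e_def I_def the_inv_into_f_f)
  have e_B: "e n \<in> B" if "n \<in> I" for n
    using that e_nat by (auto simp: I_def)
  have e_0: "e n = 0" if "n \<notin> I" for n using that by (simp add: e_def)
  have neq: "e i \<noteq> e j" if "i \<in> I" "j \<in> I" "i \<noteq> j" for i j
    using that e_nat by (auto simp: I_def)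
  have "onb_sequence e"
  proof
    fix i j :: nat
    show "e i \<bullet> e j = 0" if "i \<noteq> j"
      using B that neq[of i j] e_B[of i] e_B[of j] e_0[of i] e_0[of j]
      by (cases "i \<in> I"; cases "j \<in> I") (auto simp: orthonormal_basis_def pairwise_def orthogonal_def)
    show "e i \<bullet> e i = 0 \<or> e i \<bullet> e i = 1"
      using B e_B[of i] e_0[of i]
      by (cases "i \<in> I") (auto simp: orthonormal_basis_def simp flip: power2_norm_eq_inner)
    have "B \<subseteq> range e" using e_nat by (metis rangeI subsetI)
    then have "closure (span B) \<subseteq> closure (span (range e))" by (intro closure_mono span_mono)
    then show "closure (span (range e)) = UNIV" using B by (auto simp: orthonormal_basis_def)
  qed
  moreover have "infsum g B = (\<Sum>n. g (e n))"
    if g: "g 0 = 0" "\<And>n. g (e n) \<ge> 0" "summable (\<lambda>n. g (e n))" for g :: "'a \<Rightarrow> real"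
  proof -
    have "infsum g B = infsum (g \<circ> e \<circ> to_nat_on B) B"
      by (intro infsum_cong) (simp add: e_nat)
    also have "\<dots> = infsum (g \<circ> e) I"
      unfolding I_def by (rule infsum_reindex[OF inj, symmetric])
    \<comment> \<open>Padded indices contribute \<open>g 0\<close>, which is why
      \<open>g 0 = 0\<close> is demanded.\<close>
    also have "\<dots> = infsum (g \<circ> e) UNIV"
      by (intro infsum_cong_neutral) (auto simp: e_0 g(1))
    also have "\<dots> = (\<Sum>n. g (e n))"
      using g by (intro infsumI) (auto simp: o_def intro!: norm_summable_imp_has_sum summable_sums)
    finally show ?thesis .
  qed
  ultimately show ?thesis by blast
qed

section \<open>Covariance operators\<close>

definition covariance_operator :: "('a::real_inner \<Rightarrow> 'a) \<Rightarrow> bool" where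
  "covariance_operator A \<longleftrightarrow> bounded_linear A \<and> symmetric_operator A \<and> positive_operator A"

lemma covariance_operatorD:
  assumes "covariance_operator A"
  shows "bounded_linear A" "A a \<bullet> b = a \<bullet> A b" "A a \<bullet> a \<ge> 0"
    "A (a + b) = A a + A b" "A (a - b) = A a - A b" "A (r *\<^sub>R a) = r *\<^sub>R A a" "A 0 = 0"
  using assms bounded_linear.linear[of A]
  by (auto simp: covariance_operator_def symmetric_operator_def positive_operator_def
      linear_add linear_diff linear_scale linear_0)

lemma covariance_cauchy_schwarz:
  assumes A: "covariance_operator A"
  shows "(A a \<bullet> b)\<^sup>2 \<le> (A a \<bullet> a) * (A b \<bullet> b)"
proof -
  define p q r where "p = A a \<bullet> a" "q = A a \<bullet> b" "r = A b \<bullet> b"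
  have quad: "p + 2 * t * q + t\<^sup>2 * r \<ge> 0" for t
  proof -
    have "A b \<bullet> a = q" unfolding p_q_r_def covariance_operatorD(2)[OF A, of b a]
      by (rule inner_commute)
    then have "A (a + t *\<^sub>R b) \<bullet> (a + t *\<^sub>R b) = p + 2 * t * q + t\<^sup>2 * r"
      by (simp add: covariance_operatorD[OF A] p_q_r_def inner_add algebra_simps power2_eq_square)
    then show ?thesis using covariance_operatorD(3)[OF A, of "a + t *\<^sub>R b"] by simp
  qed
  have "r \<ge> 0" "p \<ge> 0" using covariance_operatorD(3)[OF A] by (auto simp: p_q_r_def)
  have "q\<^sup>2 \<le> p * r"
  proof (cases "r = 0")
    case True
    have "q = 0"
    proof (rule ccontr)
      assume "q \<noteq> 0"
      \<comment> \<open>For r = 0 the quadratic is affine in t, and this t gives it the value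
        -1.\<close>
      then show False using quad[of "- (p + 1) / (2 * q)"] True by (simp add: field_simps)
    qed
    then show ?thesis using True by simp
  next
    case False
    then have "r > 0" using \<open>r \<ge> 0\<close> by simp
    \<comment> \<open>The minimizer of the quadratic in t.\<close>
    have "0 \<le> p + 2 * (- q / r) * q + (- q / r)\<^sup>2 * r" by (rule quad)
    also have "\<dots> = p - q\<^sup>2 / r" using \<open>r > 0\<close> by (simp add: field_simps power2_eq_square)
    finally show ?thesis using \<open>r > 0\<close> by (simp add: field_simps)
  qed
  then show ?thesis by (simp add: p_q_r_def)
qed

text \<open>Polarisation. It justifies working with the diagonal forms alone until the skew equation
  is stated for operators.\<close>

lemma covariance_eqI:
  assumes "bounded_linear A" "symmetric_operator A" "bounded_linear B" "symmetric_operator B"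
    and eq: "\<And>a. A a \<bullet> a = B a \<bullet> a"
  shows "A = B"
proof
  note lin = linear_add[OF bounded_linear.linear[OF assms(1)]] linear_add[OF bounded_linear.linear[OF assms(3)]]
  have sym: "A x \<bullet> y = A y \<bullet> x" "B x \<bullet> y = B y \<bullet> x" for x y
    using assms(2,4) by (auto simp: symmetric_operator_def inner_commute)
  fix a
  have "A a \<bullet> b = B a \<bullet> b" for b
    using eq[of "a + b"] eq[of a] eq[of b] sym[of a b] by (simp add: lin inner_add)
  then show "A a = B a" by (metis vector_eq_rdot)
qed

section \<open>Schur complements and the Cholesky factorization\<close>

text \<open>The column removed by one elimination step in direction v. If <A v, v> = 0, division by
  zero makes it 0; this is the right value, since then A v = 0 for a positive A.\<close>

definition pivot :: "('a::real_inner \<Rightarrow> 'a) \<Rightarrow> 'a \<Rightarrow> 'a" where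
  "pivot A v = (1 / sqrt (A v \<bullet> v)) *\<^sub>R A v"

definition schur_complement :: "('a::real_inner \<Rightarrow> 'a) \<Rightarrow> 'a \<Rightarrow> 'a \<Rightarrow> 'a" where
  "schur_complement A v a = A a - (a \<bullet> pivot A v) *\<^sub>R pivot A v"

text \<open>Positivity is the Cauchy-Schwarz inequality for the form of A. Vectors already
  annihilated stay annihilated, so elimination can be iterated along the basis.\<close>

lemma covariance_schur_complement:
  assumes A: "covariance_operator A"
  shows "covariance_operator (schur_complement A v)"
    and "schur_complement A v v = 0"
    and "A u = 0 \<Longrightarrow> schur_complement A v u = 0"
proof -
  let ?w = "pivot A v"
  have sq: "(a \<bullet> ?w)\<^sup>2 = (A v \<bullet> a)\<^sup>2 / (A v \<bullet> v)" for a
    using covariance_operatorD(3)[OF A, of v]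
    by (simp add: pivot_def power_mult_distrib power_divide inner_commute)
  have "(a \<bullet> ?w)\<^sup>2 \<le> A a \<bullet> a" for a
  proof (cases "A v \<bullet> v = 0")
    case True
    then show ?thesis using sq covariance_operatorD(3)[OF A] by simp
  next
    case False
    then have "A v \<bullet> v > 0" using covariance_operatorD(3)[OF A, of v] by simp
    then show ?thesis using covariance_cauchy_schwarz[OF A, of v a]
      by (simp add: sq field_simps)
  qed
  then have "positive_operator (schur_complement A v)"
    by (simp add: positive_operator_def schur_complement_def inner_diff power2_eq_square inner_commute)
  moreover have "bounded_linear (schur_complement A v)"
    unfolding schur_complement_def
    by (intro bounded_linear_sub covariance_operatorD(1)[OF A]
        bounded_linear_compose[OF bounded_linear_scaleR_left] bounded_linear_inner_left)
  moreover have "symmetric_operator (schur_complement A v)"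
    unfolding symmetric_operator_def schur_complement_def
    by (simp add: inner_diff covariance_operatorD(2)[OF A] inner_commute[of _ "pivot A v"] mult_ac)
  ultimately show "covariance_operator (schur_complement A v)"
    by (simp add: covariance_operator_def)
  show "schur_complement A v v = 0"
  proof (cases "A v \<bullet> v = 0")
    case True
    \<comment> \<open>Cauchy-Schwarz with second vector A v turns <A v, v> = 0 into A v = 0.\<close>
    then have "(A v \<bullet> A v)\<^sup>2 \<le> 0" using covariance_cauchy_schwarz[OF A, of v "A v"] by simp
    then have "A v = 0" by simp
    then show ?thesis by (simp add: schur_complement_def pivot_def)
  next
    case False
    then have "A v \<bullet> v > 0" using covariance_operatorD(3)[OF A, of v] by simp
    then show ?thesis by (simp add: schur_complement_def pivot_def inner_commute)
  qed
  show "schur_complement A v u = 0" if "A u = 0"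
    using that covariance_operatorD(2)[OF A, of u v] by (simp add: schur_complement_def pivot_def)
qed

context onb_sequence
begin

text \<open>For a positive operator this says that the trace is at most C. Bounding finite partial
  sums needs no convergence and survives weak limits.\<close>

definition trace_le :: "('a \<Rightarrow> 'a) \<Rightarrow> real \<Rightarrow> bool" where
  "trace_le A C \<longleftrightarrow> (\<forall>N. (\<Sum>m<N. A (e m) \<bullet> e m) \<le> C)"

primrec cholesky :: "('a \<Rightarrow> 'a) \<Rightarrow> nat \<Rightarrow> 'a \<Rightarrow> 'a" where
  "cholesky A 0 = A"
| "cholesky A (Suc n) = schur_complement (cholesky A n) (e n)"

text \<open>The Cholesky decomposition replaces the square root of a positive operator.\<close>

lemma covariance_factorization:
  assumes A: "covariance_operator A" and C: "trace_le A C"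
  obtains x where "\<And>N. (\<Sum>n<N. (norm (x n))\<^sup>2) \<le> C"
    and "summable (\<lambda>n. (norm (x n))\<^sup>2)"
    and "\<And>a. (\<lambda>n. (a \<bullet> x n) *\<^sub>R x n) sums A a"
    and "\<And>a. (\<lambda>n. (a \<bullet> x n)\<^sup>2) sums (A a \<bullet> a)"
proof -
  define x where "x n = pivot (cholesky A n) (e n)" for n
  have cov: "covariance_operator (cholesky A n)" for n
    by (induction n) (auto simp: A covariance_schur_complement)
  \<comment> \<open>After n steps the remainder vanishes on the first n basis vectors.\<close>
  have kill: "cholesky A n (e k) = 0" if "k < n" for n k
    using that
  proof (induction n)
    case (Suc n)
    then show ?case
      using covariance_schur_complement(2,3)[OF cov[of n]] by (cases "k = n") auto
  qed simp
  have split: "A a = cholesky A n a + (\<Sum>k<n. (a \<bullet> x k) *\<^sub>R x k)" for n a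
    by (induction n) (auto simp: schur_complement_def x_def)
  have split_form: "(\<Sum>k<n. (a \<bullet> x k)\<^sup>2) \<le> A a \<bullet> a" for n a
  proof -
    have "A a \<bullet> a = cholesky A n a \<bullet> a + (\<Sum>k<n. (a \<bullet> x k) * (x k \<bullet> a))"
      by (subst split[of a n]) (simp add: inner_add_left inner_sum_left)
    then show ?thesis
      using covariance_operatorD(3)[OF cov, of n a] by (simp add: power2_eq_square inner_commute)
  qed
  show thesis
  proof (rule that[of x])
    \<comment> \<open>Parseval for each \<open>x n\<close>, the two sums interchanged, then
      \<open>split_form\<close> at each basis vector.\<close>
    show sumC: "(\<Sum>n<N. (norm (x n))\<^sup>2) \<le> C" for N
    proof (rule LIMSEQ_le_const2)
      have "(\<lambda>m. \<Sum>n<N. (x n \<bullet> e m)\<^sup>2) sums (\<Sum>n<N. (norm (x n))\<^sup>2)"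
        by (intro sums_sum parseval)
      then show "(\<lambda>M. \<Sum>m<M. \<Sum>n<N. (x n \<bullet> e m)\<^sup>2) \<longlonglongrightarrow> (\<Sum>n<N. (norm (x n))\<^sup>2)"
        by (simp add: sums_def)
      have "(\<Sum>m<M. \<Sum>n<N. (x n \<bullet> e m)\<^sup>2) \<le> C" for M
      proof -
        have "(\<Sum>m<M. \<Sum>n<N. (x n \<bullet> e m)\<^sup>2) \<le> (\<Sum>m<M. A (e m) \<bullet> e m)"
          using split_form by (intro sum_mono) (simp add: inner_commute)
        also have "\<dots> \<le> C" using C by (simp add: trace_le_def)
        finally show ?thesis .
      qed
      then show "\<exists>N'. \<forall>M\<ge>N'. (\<Sum>m<M. \<Sum>n<N. (x n \<bullet> e m)\<^sup>2) \<le> C" by blast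
    qed
    show sm: "summable (\<lambda>n. (norm (x n))\<^sup>2)"
      using sumC by (intro summableI_nonneg_bounded) auto
    show S: "(\<lambda>n. (a \<bullet> x n) *\<^sub>R x n) sums A a" for a
    proof -
      define S where "S a = (\<Sum>n. (a \<bullet> x n) *\<^sub>R x n)" for a
      have bd: "norm ((a \<bullet> x n) *\<^sub>R x n) \<le> norm a * (norm (x n))\<^sup>2" for a n
        using mult_right_mono[OF Cauchy_Schwarz_ineq2[of a "x n"], of "norm (x n)"]
        by (simp add: power2_eq_square mult.assoc)
      have S: "(\<lambda>n. (a \<bullet> x n) *\<^sub>R x n) sums S a" for a
        unfolding S_def
        by (intro summable_sums summable_of_norm_le[OF _ bd] summable_mult sm)
      have "bounded_linear S"
      proof (rule bounded_linear_intro[where K = "C"])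
        fix a b and r :: real
        show "S (a + b) = S a + S b"
          using sums_add[OF S[of a] S[of b]] S[of "a + b"]
          by (intro sums_unique2[OF S]) (simp add: inner_add scaleR_add_left)
        show "S (r *\<^sub>R a) = r *\<^sub>R S a"
          using sums_scaleR_right[OF S[of a], of r]
          by (intro sums_unique2[OF S]) simp
        show "norm (S a) \<le> norm a * C"
        proof (rule LIMSEQ_le_const2[OF tendsto_norm[OF S[of a, unfolded sums_def]]])
          have "norm (\<Sum>k<n. (a \<bullet> x k) *\<^sub>R x k) \<le> norm a * C" for n
          proof -
            have "norm (\<Sum>k<n. (a \<bullet> x k) *\<^sub>R x k) \<le> (\<Sum>k<n. norm a * (norm (x k))\<^sup>2)"
              by (intro sum_norm_le bd)
            also have "\<dots> \<le> norm a * C"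
              unfolding sum_distrib_left[symmetric] by (intro mult_left_mono sumC) auto
            finally show ?thesis .
          qed
          then show "\<exists>N. \<forall>n\<ge>N. norm (\<Sum>k<n. (a \<bullet> x k) *\<^sub>R x k) \<le> norm a * C" by blast
        qed
      qed
      \<comment> \<open>At a basis vector the elimination is exact after finitely many steps.
        Agreement there suffices because both operators are bounded.\<close>
      moreover have "A (e k) = S (e k)" for k
      proof (rule LIMSEQ_unique[OF _ S[of "e k", unfolded sums_def]])
        have "(\<Sum>j<n. (e k \<bullet> x j) *\<^sub>R x j) = A (e k)" if "n > k" for n
          using split[of "e k" n] kill[OF that] by simp
        then show "(\<lambda>n. \<Sum>j<n. (e k \<bullet> x j) *\<^sub>R x j) \<longlonglongrightarrow> A (e k)"
          by (intro tendsto_eventually) (auto simp: eventually_sequentially intro!: exI[of _ "Suc k"])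
      qed
      ultimately have "A a = S a"
        by (rule bounded_linear_eqI[where f = A and g = S, OF covariance_operatorD(1)[OF A]])
      then show ?thesis using S by simp
    qed
    show "(\<lambda>n. (a \<bullet> x n)\<^sup>2) sums (A a \<bullet> a)" for a
      using bounded_linear.sums[OF bounded_linear_inner_left S[of a], of a]
      by (simp add: power2_eq_square inner_commute)
  qed
qed

lemma trace_le_nonneg: "trace_le A C \<Longrightarrow> C \<ge> 0"
  unfolding trace_le_def by (metis lessThan_0 sum.empty)

text \<open>The form is the sum of <a, x_n>^2 over the factorization, and the |x_n|^2 add up to at
  most C.\<close>

lemma covariance_form_le:
  assumes A: "covariance_operator A" and C: "trace_le A C"
  shows "A a \<bullet> a \<le> C * (norm a)\<^sup>2"
proof -
  from covariance_factorization[OF assms] obtain x where x: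
    "\<And>N. (\<Sum>n<N. (norm (x n))\<^sup>2) \<le> C" "\<And>a. (\<lambda>n. (a \<bullet> x n)\<^sup>2) sums (A a \<bullet> a)" by metis
  have "(\<Sum>n<N. (a \<bullet> x n)\<^sup>2) \<le> C * (norm a)\<^sup>2" for N
  proof -
    have "(\<Sum>n<N. (a \<bullet> x n)\<^sup>2) \<le> (\<Sum>n<N. (norm a)\<^sup>2 * (norm (x n))\<^sup>2)"
      by (intro sum_mono) (metis Cauchy_Schwarz_ineq power2_norm_eq_inner)
    also have "\<dots> \<le> (norm a)\<^sup>2 * C"
      unfolding sum_distrib_left[symmetric] by (intro mult_left_mono x(1)) auto
    finally show ?thesis by (simp add: mult.commute)
  qed
  then show ?thesis using x(2)[of a] by (intro LIMSEQ_le_const2) (auto simp: sums_def)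
qed

lemma covariance_bilinear_le:
  assumes A: "covariance_operator A" and C: "trace_le A C"
  shows "\<bar>A a \<bullet> b\<bar> \<le> C * norm a * norm b"
proof -
  have "(A a \<bullet> b)\<^sup>2 \<le> (A a \<bullet> a) * (A b \<bullet> b)" by (rule covariance_cauchy_schwarz[OF A])
  also have "\<dots> \<le> (C * (norm a)\<^sup>2) * (C * (norm b)\<^sup>2)"
    using trace_le_nonneg[OF C]
    by (intro mult_mono covariance_form_le assms covariance_operatorD(3)[OF A]) auto
  also have "\<dots> = (C * norm a * norm b)\<^sup>2" by (simp add: power2_eq_square)
  finally have "\<bar>A a \<bullet> b\<bar> \<le> \<bar>C * norm a * norm b\<bar>" by (simp add: abs_le_square_iff)
  then show ?thesis using trace_le_nonneg[OF C] by simp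
qed

lemma covariance_conjugate:
  fixes F :: "'a \<Rightarrow> 'a"
  assumes A: "covariance_operator A" and F: "bounded_linear F"
  shows "covariance_operator (\<lambda>a. F (A (adjoint F a)))"
    and "F (A (adjoint F a)) \<bullet> b = A (adjoint F a) \<bullet> adjoint F b"
proof -
  show *: "F (A (adjoint F a)) \<bullet> b = A (adjoint F a) \<bullet> adjoint F b" for a b
    by (rule adjoint_works[OF F])
  show "covariance_operator (\<lambda>a. F (A (adjoint F a)))"
    unfolding covariance_operator_def
  proof (intro conjI)
    show "bounded_linear (\<lambda>a. F (A (adjoint F a)))"
      by (rule bounded_linear_compose[OF F bounded_linear_compose[OF covariance_operatorD(1)[OF A]
              bounded_linear_adjoint(1)[OF F]]])
    show "symmetric_operator (\<lambda>a. F (A (adjoint F a)))"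
      unfolding symmetric_operator_def * by (metis * covariance_operatorD(2)[OF A] inner_commute)
    show "positive_operator (\<lambda>a. F (A (adjoint F a)))"
      unfolding positive_operator_def * using covariance_operatorD(3)[OF A] by blast
  qed
qed

text \<open>With A factored by vectors x_n, the conjugate is factored by F x_n; Bessel bounds the
  basis sum of <F x_n, e_m>^2 by |F x_n|^2.\<close>

lemma trace_le_conjugate:
  assumes A: "covariance_operator A" and C: "trace_le A C"
    and F: "bounded_linear F" and c: "\<And>x. norm (F x) \<le> c * norm x"
  shows "trace_le (\<lambda>a. F (A (adjoint F a))) (c\<^sup>2 * C)"
proof -
  from covariance_factorization[OF A C] obtain x where x:
    "\<And>N. (\<Sum>n<N. (norm (x n))\<^sup>2) \<le> C" "\<And>a. (\<lambda>n. (a \<bullet> x n)\<^sup>2) sums (A a \<bullet> a)" by metis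
  have "(\<Sum>m<N. F (A (adjoint F (e m))) \<bullet> e m) \<le> c\<^sup>2 * C" for N
  proof -
    have "(\<lambda>n. (F (x n) \<bullet> e m)\<^sup>2) sums (F (A (adjoint F (e m))) \<bullet> e m)" for m
      unfolding covariance_conjugate(2)[OF A F] adjoint_works[OF F]
      using x(2)[of "adjoint F (e m)"] by (simp add: inner_commute)
    then have "(\<lambda>n. \<Sum>m<N. (F (x n) \<bullet> e m)\<^sup>2) sums (\<Sum>m<N. F (A (adjoint F (e m))) \<bullet> e m)"
      by (intro sums_sum)
    moreover have "(\<Sum>n<K. \<Sum>m<N. (F (x n) \<bullet> e m)\<^sup>2) \<le> c\<^sup>2 * C" for K
    proof -
      have "(\<Sum>n<K. \<Sum>m<N. (F (x n) \<bullet> e m)\<^sup>2) \<le> (\<Sum>n<K. c\<^sup>2 * (norm (x n))\<^sup>2)"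
      proof (rule sum_mono)
        fix n
        have "(\<Sum>m<N. (F (x n) \<bullet> e m)\<^sup>2) \<le> (norm (F (x n)))\<^sup>2" by (rule bessel)
        also have "\<dots> \<le> (c * norm (x n))\<^sup>2" by (intro power_mono c) auto
        finally show "(\<Sum>m<N. (F (x n) \<bullet> e m)\<^sup>2) \<le> c\<^sup>2 * (norm (x n))\<^sup>2"
          by (simp add: power_mult_distrib)
      qed
      also have "\<dots> \<le> c\<^sup>2 * C"
        unfolding sum_distrib_left[symmetric] by (intro mult_left_mono x(1)) auto
      finally show ?thesis .
    qed
    ultimately show ?thesis by (intro LIMSEQ_le_const2) (auto simp: sums_def)
  qed
  then show ?thesis by (simp add: trace_le_def)
qed

text \<open>The factorization is itself a nuclear representation, with both sequences equal to
  x.\<close>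

lemma nuclear_operator_if_trace_le:
  assumes "covariance_operator A" "trace_le A C"
  shows "nuclear_operator A"
proof -
  from covariance_factorization[OF assms] obtain x where
    "summable (\<lambda>n. (norm (x n))\<^sup>2)" "\<And>a. (\<lambda>n. (a \<bullet> x n) *\<^sub>R x n) sums A a" by metis
  then show ?thesis
    unfolding nuclear_operator_def using covariance_operatorD(1)[OF assms(1)]
    by (intro conjI exI[of _ x]) (auto simp: power2_eq_square)
qed

text \<open>The first N diagonal entries of a rank-one term add up to <P_N x_n, y_n>, and P_N is a
  contraction.\<close>

lemma trace_le_if_nuclear_operator:
  assumes "nuclear_operator A"
  shows "\<exists>C. trace_le A C"
proof -
  from assms obtain x y where sm: "summable (\<lambda>n. norm (x n) * norm (y n))"
    and s: "\<And>a. (\<lambda>n. (a \<bullet> x n) *\<^sub>R y n) sums A a"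
    unfolding nuclear_operator_def by blast
  have "(\<Sum>m<N. A (e m) \<bullet> e m) \<le> (\<Sum>n. norm (x n) * norm (y n))" for N
  proof (rule sums_le[OF _ _ summable_sums[OF sm]])
    have "(\<lambda>n. (e m \<bullet> x n) * (y n \<bullet> e m)) sums (A (e m) \<bullet> e m)" for m
      using bounded_linear.sums[OF bounded_linear_inner_left s[of "e m"], of "e m"] by simp
    then show "(\<lambda>n. \<Sum>m<N. (e m \<bullet> x n) * (y n \<bullet> e m)) sums (\<Sum>m<N. A (e m) \<bullet> e m)"
      by (intro sums_sum)
    fix n
    have "(\<Sum>m<N. (e m \<bullet> x n) * (y n \<bullet> e m)) = proj N (x n) \<bullet> y n"
      unfolding proj_inner by (simp add: inner_commute)
    also have "\<dots> \<le> norm (proj N (x n)) * norm (y n)" by (rule norm_cauchy_schwarz)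
    also have "\<dots> \<le> norm (x n) * norm (y n)" by (intro mult_right_mono norm_proj_le) auto
    finally show "(\<Sum>m<N. (e m \<bullet> x n) * (y n \<bullet> e m)) \<le> norm (x n) * norm (y n)" .
  qed
  then show ?thesis unfolding trace_le_def by blast
qed

end

section \<open>Uniform boundedness and weak compactness\<close>

text \<open>Baire category, as usual. It turns strong continuity of T into a norm bound that is
  uniform on compact time intervals.\<close>

lemma banach_steinhaus:
  fixes T :: "'i \<Rightarrow> 'a::{real_normed_vector, complete_space} \<Rightarrow> 'b::real_normed_vector"
  assumes lin: "\<And>i. i \<in> I \<Longrightarrow> bounded_linear (T i)"
    and bd: "\<And>x. \<exists>K. \<forall>i\<in>I. norm (T i x) \<le> K"
  shows "\<exists>C\<ge>0. \<forall>i\<in>I. \<forall>x. norm (T i x) \<le> C * norm x"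
proof -
  define A where "A k = {x. \<forall>i\<in>I. norm (T i x) \<le> real k}" for k
  have closed: "closed (A k)" for k
  proof -
    have "A k = (\<Inter>i\<in>I. {x. norm (T i x) \<le> real k})" by (auto simp: A_def)
    moreover have "closed {x. norm (T i x) \<le> real k}" if "i \<in> I" for i
      by (intro closed_Collect_le continuous_on_norm linear_continuous_on lin[OF that] continuous_on_const)
    ultimately show ?thesis by auto
  qed
  have "\<exists>k. interior (A k) \<noteq> {}"
  proof (rule ccontr)
    assume "\<not> ?thesis"
    then have "euclidean interior_of (\<Union>(range A)) = {}"
      using closed by (intro Baire_category_alt) (auto simp: completely_metrizable_space_euclidean)
    moreover have "x \<in> \<Union>(range A)" for x
    proof -
      obtain K where "\<forall>i\<in>I. norm (T i x) \<le> K" using bd by blast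
      then have "x \<in> A (nat \<lceil>K\<rceil>)" unfolding A_def using real_nat_ceiling_ge[of K] order_trans by blast
      then show ?thesis by blast
    qed
    then have "\<Union>(range A) = UNIV" by blast
    ultimately show False by simp
  qed
  then obtain k x\<^sub>0 where "x\<^sub>0 \<in> interior (A k)" by blast
  then obtain r where r: "r > 0" "cball x\<^sub>0 r \<subseteq> A k" using mem_interior_cball by blast
  have "norm (T i x) \<le> (2 * real k / r) * norm x" if i: "i \<in> I" for i x
  proof (cases "x = 0")
    case True
    then show ?thesis using lin[OF i] by (simp add: linear_simps)
  next
    case False
    define y where "y = (r / norm x) *\<^sub>R x"
    have "x\<^sub>0 + y \<in> cball x\<^sub>0 r" "x\<^sub>0 \<in> cball x\<^sub>0 r"
      using r(1) False by (auto simp: y_def dist_norm)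
    then have "norm (T i (x\<^sub>0 + y)) \<le> real k" "norm (T i x\<^sub>0) \<le> real k"
      using r(2)[THEN subsetD] i unfolding A_def by blast+
    moreover have "T i y = T i (x\<^sub>0 + y) - T i x\<^sub>0" using lin[OF i] by (simp add: linear_simps)
    ultimately have "norm (T i y) \<le> 2 * real k"
      using norm_triangle_ineq4[of "T i (x\<^sub>0 + y)" "T i x\<^sub>0"] by simp
    moreover have "norm (T i y) = r / norm x * norm (T i x)"
      using lin[OF i] r(1) by (simp add: y_def linear_simps)
    ultimately show ?thesis using r(1) False by (simp add: field_simps)
  qed
  moreover have "2 * real k / r \<ge> 0" using r(1) by simp
  ultimately show ?thesis by blast
qed

section \<open>One-variable calculus for difference quotients\<close>

lemma continuous_on_atLeastI:
  fixes f :: "real \<Rightarrow> 'b::topological_space"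
  assumes "\<And>b. b > a \<Longrightarrow> continuous_on {a..b} f"
  shows "continuous_on {a..} f"
  unfolding continuous_on_eq_continuous_within
proof
  fix x assume x: "x \<in> {a..}"
  have "continuous (at x within {a..x + 1}) f"
    using assms[of "x + 1"] x by (auto simp: continuous_on_eq_continuous_within)
  moreover have "at x within {a..x + 1} = at x within {a..}"
    by (rule at_within_nhd[where S = "{..<x + 1}"]) auto
  ultimately show "continuous (at x within {a..}) f" by simp
qed

text \<open>With a primitive \<Phi> of \<phi>, the integral is the difference quotient of \<Phi> at
  t minus the one at s. Continuity of \<phi> is therefore enough, without differentiability.\<close>

lemma integral_difference_quotient_tendsto:
  fixes \<phi> :: "real \<Rightarrow> real"
  assumes cont: "continuous_on {s..} \<phi>" and "s \<le> t"
    and h: "\<And>k. h k > 0" "h \<longlonglongrightarrow> 0"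
  shows "(\<lambda>k. integral {s..t} (\<lambda>\<rho>. (\<phi> (\<rho> + h k) - \<phi> \<rho>) / h k)) \<longlonglongrightarrow> \<phi> t - \<phi> s"
proof -
  define \<Phi> where "\<Phi> x = integral {s..x} \<phi>" for x
  have cont': "continuous_on {u..v} \<phi>" if "s \<le> u" for u v
    using that by (intro continuous_on_subset[OF cont]) auto
  have deriv: "(\<lambda>k. (\<Phi> (x + h k) - \<Phi> x) / h k) \<longlonglongrightarrow> \<phi> x" if "s \<le> x" for x
  proof -
    have "(\<Phi> has_real_derivative \<phi> x) (at x within {s..x + 1})"
      unfolding \<Phi>_def using that by (intro integral_has_real_derivative cont') auto
    then have "((\<lambda>y. (\<Phi> y - \<Phi> x) / (y - x)) \<longlongrightarrow> \<phi> x) (at x within {s..x + 1})"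
      by (simp add: has_field_derivative_iff)
    moreover have "filterlim (\<lambda>k. x + h k) (at x within {s..x + 1}) sequentially"
      unfolding filterlim_at
    proof
      have "\<forall>\<^sub>F k in sequentially. h k < 1" using order_tendstoD(2)[OF h(2), of 1] by simp
      then show "\<forall>\<^sub>F k in sequentially. x + h k \<in> {s..x + 1} \<and> x + h k \<noteq> x"
        by eventually_elim (use h(1) that in \<open>auto simp: less_imp_le add_increasing2 order_less_imp_not_eq2\<close>)
      show "(\<lambda>k. x + h k) \<longlonglongrightarrow> x" using tendsto_add[OF tendsto_const h(2), of x] by simp
    qed
    ultimately have "((\<lambda>y. (\<Phi> y - \<Phi> x) / (y - x)) \<circ> (\<lambda>k. x + h k)) \<longlonglongrightarrow> \<phi> x"
      unfolding comp_def by (rule filterlim_compose)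
    then show ?thesis by (simp add: o_def)
  qed
  have "integral {s..t} (\<lambda>\<rho>. (\<phi> (\<rho> + h k) - \<phi> \<rho>) / h k)
      = (\<Phi> (t + h k) - \<Phi> t) / h k - (\<Phi> (s + h k) - \<Phi> s) / h k" for k
  proof -
    have hk: "h k > 0" by (rule h)
    have shift: "integral {s..t} (\<lambda>\<rho>. \<phi> (\<rho> + h k)) = integral {s + h k..t + h k} \<phi>"
      using integral_shift_real_ivl[of "s + h k" "h k" "t + h k" \<phi>] by simp
    have "\<Phi> (s + h k) + integral {s + h k..t + h k} \<phi> = \<Phi> (t + h k)"
      unfolding \<Phi>_def using hk \<open>s \<le> t\<close>
      by (intro Henstock_Kurzweil_Integration.integral_combine integrable_continuous_interval cont') auto
    then have comb: "integral {s + h k..t + h k} \<phi> = \<Phi> (t + h k) - \<Phi> (s + h k)" by simp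
    have "continuous_on {s..t} (\<lambda>\<rho>. \<phi> (\<rho> + h k))"
      by (rule continuous_on_compose2[OF cont]) (use hk in \<open>auto intro!: continuous_intros\<close>)
    then have "integral {s..t} (\<lambda>\<rho>. (\<phi> (\<rho> + h k) - \<phi> \<rho>) / h k)
       = (integral {s..t} (\<lambda>\<rho>. \<phi> (\<rho> + h k)) - integral {s..t} \<phi>) / h k"
      by (subst Henstock_Kurzweil_Integration.integral_diff[symmetric])
         (auto intro!: integrable_continuous_interval cont')
    also have "\<dots> = (\<Phi> (t + h k) - \<Phi> (s + h k) - \<Phi> t) / h k"
      unfolding shift comb by (simp add: \<Phi>_def)
    also have "\<dots> = (\<Phi> (t + h k) - \<Phi> t) / h k - (\<Phi> (s + h k) - \<Phi> s) / h k"
      by (simp add: \<Phi>_def diff_divide_distrib)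
    finally show ?thesis .
  qed
  then show ?thesis using tendsto_diff[OF deriv[OF \<open>s \<le> t\<close>] deriv[of s]] by simp
qed

text \<open>The first part recovers the density at s from \<phi> alone and so pins down U_s. The
  second feeds the fundamental theorem of calculus on (0, t).\<close>

lemma integral_right_derivative:
  fixes \<phi> c :: "real \<Rightarrow> real"
  assumes "continuous_on {s..} c"
    and eq: "\<And>t. t \<ge> s \<Longrightarrow> integral {s..t} c = \<phi> t - \<phi> s"
  shows "((\<lambda>h. (\<phi> (s + h) - \<phi> s) / h) \<longlongrightarrow> c s) (at_right 0)"
    and "\<And>x. x > s \<Longrightarrow> (\<phi> has_real_derivative c x) (at x)"
proof -
  have cont: "continuous_on {s..b} c" for b by (rule continuous_on_subset[OF assms(1)]) auto
  have "((\<lambda>t. integral {s..t} c) has_real_derivative c s) (at s within {s..s + 1})"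
    by (intro integral_has_real_derivative cont) auto
  then have "((\<lambda>y. integral {s..y} c / (y - s)) \<longlongrightarrow> c s) (at_right s)"
    by (simp add: has_field_derivative_iff at_within_Icc_at_right)
  then have "((\<lambda>y. (\<phi> y - \<phi> s) / (y - s)) \<longlongrightarrow> c s) (at_right s)"
    by (rule Lim_transform_eventually) (auto simp: eventually_at_right_field eq intro!: exI[of _ "s + 1"])
  then show "((\<lambda>h. (\<phi> (s + h) - \<phi> s) / h) \<longlongrightarrow> c s) (at_right 0)"
    by (simp add: filterlim_at_right_to_0[of _ _ s] add.commute)
  show "(\<phi> has_real_derivative c x) (at x)" if "x > s" for x
  proof -
    have "((\<lambda>t. integral {s..t} c) has_real_derivative c x) (at x within {s..x + 1})"
      using that by (intro integral_has_real_derivative cont) auto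
    then have "((\<lambda>t. integral {s..t} c) has_real_derivative c x) (at x)"
      using that by (simp add: at_within_Icc_at)
    then have "((\<lambda>t. \<phi> s + integral {s..t} c) has_real_derivative c x) (at x)"
      by (auto intro!: derivative_eq_intros)
    then show ?thesis
      by (rule has_field_derivative_transform_within_open[where S = "{s<..}"])
         (use that in \<open>auto simp: eq\<close>)
  qed
qed

context onb_sequence
begin

text \<open>A diagonal subsequence makes all matrix entries converge. The uniform form bound extends
  this to all vectors, one argument at a time, and Riesz representation produces the limit
  operator.\<close>

lemma covariance_weak_compactness:
  assumes A: "\<And>n. covariance_operator (A n)" and C: "\<And>n. trace_le (A n) C"
  obtains r U where "strict_mono (r :: nat \<Rightarrow> nat)" "covariance_operator U" "trace_le U C"
    "\<And>a b. (\<lambda>n. A (r n) a \<bullet> b) \<longlonglongrightarrow> U a \<bullet> b"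
proof -
  \<comment> \<open>\<open>prod_decode\<close> enumerates the pairs of basis indices, as the
    diagonal argument runs over one index.\<close>
  define f where "f p n = A n (e (fst (prod_decode p))) \<bullet> e (snd (prod_decode p))" for p n
  have f_bd: "\<bar>f p n\<bar> \<le> C" for p n
  proof -
    let ?a = "e (fst (prod_decode p))" and ?b = "e (snd (prod_decode p))"
    have "norm (e k) \<le> 1" for k using normalized[of k] by (auto simp: norm_eq_sqrt_inner)
    then have "norm ?a * norm ?b \<le> 1 * 1" by (intro mult_mono) auto
    then have "C * (norm ?a * norm ?b) \<le> C * 1"
      using trace_le_nonneg[OF C] by (intro mult_left_mono) auto
    then show ?thesis
      unfolding f_def using covariance_bilinear_le[OF A C, of n ?a ?b] by (simp add: mult.assoc)
  qed
  let ?P = "\<lambda>p s. convergent (\<lambda>k. f p (s k))"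
  interpret d: subseqs ?P
  proof
    fix p and s :: "nat \<Rightarrow> nat"
    have "\<forall>k. f p (s k) \<in> {-C..C}" using f_bd by (auto simp: abs_le_iff minus_le_iff)
    then obtain l s' where "strict_mono s'" "((\<lambda>k. f p (s k)) \<circ> s') \<longlonglongrightarrow> l"
      using compact_imp_seq_compact[OF compact_Icc, of "-C" C] seq_compactE by metis
    then show "\<exists>r'. strict_mono r' \<and> ?P p (s \<circ> r')"
      by (auto simp: convergent_def o_def)
  qed
  define r where "r = d.diagseq"
  have r: "strict_mono r" unfolding r_def by (rule d.subseq_diagseq)
  have "?P p r" for p
  proof -
    \<comment> \<open>The diagonal sequence is a subsequence of the p-th one only from index
      \<open>Suc p\<close> on, so an initial segment has to be discarded.\<close>
    have "?P p (r \<circ> ((+) (Suc p)))"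
      unfolding r_def
      by (rule d.diagseq_holds) (auto simp: o_def dest: convergent_subseq_convergent)
    then show ?thesis
      using convergent_ignore_initial_segment[of "\<lambda>k. f p (r k)" "Suc p"] by (simp add: o_def add.commute)
  qed
  then have conv_ee: "convergent (\<lambda>n. A (r n) (e i) \<bullet> e j)" for i j
    using \<open>?P (prod_encode (i, j)) r\<close> by (simp add: f_def)
  have bd: "norm (A n a \<bullet> b) \<le> C * norm a * norm b" for n a b
    using covariance_bilinear_le[OF A C] by simp
  have conv_ae: "convergent (\<lambda>n. A (r n) a \<bullet> e j)" for a j
  proof (rule convergent_of_dense[where f = "\<lambda>n a. A (r n) a \<bullet> e j"])
    show "convergent (\<lambda>n. A (r n) (e k) \<bullet> e j)" for k by (rule conv_ee)
    show "linear (\<lambda>a. A (r n) a \<bullet> e j)" for n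
      by (intro linearI) (auto simp: covariance_operatorD[OF A] inner_add_left)
    show "norm (A (r n) x \<bullet> e j) \<le> C * norm (e j) * norm x" for n x
      using bd[of "r n" x "e j"] by (simp add: mult_ac)
  qed
  have conv: "convergent (\<lambda>n. A (r n) a \<bullet> b)" for a b
  proof (rule convergent_of_dense[where f = "\<lambda>n b. A (r n) a \<bullet> b"])
    show "convergent (\<lambda>n. A (r n) a \<bullet> e k)" for k by (rule conv_ae)
    show "linear (\<lambda>b. A (r n) a \<bullet> b)" for n
      by (intro linearI) (auto simp: inner_add_right)
    show "norm (A (r n) a \<bullet> x) \<le> C * norm a * norm x" for n x by (rule bd)
  qed
  define \<beta> where "\<beta> a b = lim (\<lambda>n. A (r n) a \<bullet> b)" for a b
  have \<beta>: "(\<lambda>n. A (r n) a \<bullet> b) \<longlonglongrightarrow> \<beta> a b" for a b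
    using conv[of a b] unfolding \<beta>_def by (simp add: convergent_LIMSEQ_iff)
  have "\<exists>U. bounded_linear U \<and> (\<forall>a b. U a \<bullet> b = \<beta> a b)"
  proof (rule operator_of_bounded_form)
    show "linear (\<beta> a)" for a
    proof (rule linearI)
      show "\<beta> a (x + y) = \<beta> a x + \<beta> a y" for x y
        using tendsto_add[OF \<beta>[of a x] \<beta>[of a y]]
        by (intro LIMSEQ_unique[OF \<beta>]) (simp add: inner_add_right)
      show "\<beta> a (c *\<^sub>R x) = c *\<^sub>R \<beta> a x" for c x
        using tendsto_mult_left[OF \<beta>[of a x], of c] by (intro LIMSEQ_unique[OF \<beta>]) simp
    qed
    show "linear (\<lambda>a. \<beta> a b)" for b
    proof (rule linearI)
      show "\<beta> (x + y) b = \<beta> x b + \<beta> y b" for x y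
        using tendsto_add[OF \<beta>[of x b] \<beta>[of y b]]
        by (intro LIMSEQ_unique[OF \<beta>]) (simp add: covariance_operatorD[OF A] inner_add_left)
      show "\<beta> (c *\<^sub>R x) b = c *\<^sub>R \<beta> x b" for c x
        using tendsto_mult_left[OF \<beta>[of x b], of c]
        by (intro LIMSEQ_unique[OF \<beta>]) (simp add: covariance_operatorD[OF A])
    qed
    show "\<bar>\<beta> a b\<bar> \<le> C * norm a * norm b" for a b
      using bd by (intro LIMSEQ_le_const2[OF tendsto_rabs[OF \<beta>]]) auto
  qed
  then obtain U where U: "bounded_linear U" "\<And>a b. U a \<bullet> b = \<beta> a b" by blast
  have lim: "(\<lambda>n. A (r n) a \<bullet> b) \<longlonglongrightarrow> U a \<bullet> b" for a b using \<beta> U(2) by simp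
  show thesis
  proof (rule that[OF r _ _ lim])
    have "U a \<bullet> b = a \<bullet> U b" for a b
    proof (rule LIMSEQ_unique[OF lim[of a b]])
      show "(\<lambda>n. A (r n) a \<bullet> b) \<longlonglongrightarrow> a \<bullet> U b"
        using lim[of b a] unfolding covariance_operatorD(2)[OF A, of _ a b] by (simp add: inner_commute)
    qed
    moreover have "U a \<bullet> a \<ge> 0" for a
      using covariance_operatorD(3)[OF A] by (intro LIMSEQ_le_const[OF lim[of a a]]) auto
    ultimately show "covariance_operator U"
      using U(1) by (simp add: covariance_operator_def symmetric_operator_def positive_operator_def)
    show "trace_le U C"
      unfolding trace_le_def
    proof
      fix N
      have "(\<lambda>n. \<Sum>m<N. A (r n) (e m) \<bullet> e m) \<longlonglongrightarrow> (\<Sum>m<N. U (e m) \<bullet> e m)"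
        by (intro tendsto_sum lim)
      then show "(\<Sum>m<N. U (e m) \<bullet> e m) \<le> C"
        using C by (intro LIMSEQ_le_const2) (auto simp: trace_le_def)
    qed
  qed
qed

end

section \<open>Cocycles of covariance operators\<close>

text \<open>This is all that the measures contribute; what follows concerns operators only. The
  cocycle identity is kept at the level of quadratic forms, which is what characteristic functionals
  deliver.\<close>

locale covariance_cocycle = onb_sequence e
  for e :: "nat \<Rightarrow> 'a::{real_inner, complete_space}" +
  fixes T R :: "real \<Rightarrow> 'a \<Rightarrow> 'a"
  assumes semigroup: "strongly_continuous_semigroup T"
    and covariance: "t \<ge> 0 \<Longrightarrow> covariance_operator (R t)"
    and finite_trace: "t \<ge> 0 \<Longrightarrow> \<exists>C. trace_le (R t) C"
    and cocycle: "r \<ge> 0 \<Longrightarrow> t \<ge> 0 \<Longrightarrow>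
      R (r + t) a \<bullet> a = R r (adjoint (T t) a) \<bullet> adjoint (T t) a + R t a \<bullet> a"
begin

definition S :: "real \<Rightarrow> 'a \<Rightarrow> 'a" where "S t = adjoint (T t)"

definition \<phi> :: "'a \<Rightarrow> real \<Rightarrow> real" where "\<phi> a t = R t a \<bullet> a"

lemma bounded_linear_T: "t \<ge> 0 \<Longrightarrow> bounded_linear (T t)"
  using semigroup by (simp add: strongly_continuous_semigroup_def)

lemma inner_S: "t \<ge> 0 \<Longrightarrow> x \<bullet> S t y = T t x \<bullet> y"
  unfolding S_def by (rule adjoint_works[OF bounded_linear_T, symmetric])

lemma S_0 [simp]: "S 0 a = a"
proof (rule vector_eq_ldot[THEN iffD1], rule allI)
  show "x \<bullet> S 0 a = x \<bullet> a" for x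
    using semigroup inner_S[of 0 x a] by (simp add: strongly_continuous_semigroup_def)
qed

lemma S_add: "s \<ge> 0 \<Longrightarrow> t \<ge> 0 \<Longrightarrow> S (s + t) a = S t (S s a)"
proof (rule vector_eq_ldot[THEN iffD1], rule allI)
  assume st: "s \<ge> 0" "t \<ge> 0"
  then have "T (s + t) = T s \<circ> T t" using semigroup by (simp add: strongly_continuous_semigroup_def)
  then show "x \<bullet> S (s + t) a = x \<bullet> S t (S s a)" for x
    using st by (simp add: inner_S)
qed

lemma T_locally_bounded:
  obtains K where "K \<ge> 0" "\<And>s x. 0 \<le> s \<Longrightarrow> s \<le> t \<Longrightarrow> norm (T s x) \<le> K * norm x"
    "\<And>s x. 0 \<le> s \<Longrightarrow> s \<le> t \<Longrightarrow> norm (S s x) \<le> K * norm x"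
proof -
  have "\<exists>C\<ge>0. \<forall>s\<in>{0..t}. \<forall>x. norm (T s x) \<le> C * norm x"
  proof (rule banach_steinhaus)
    fix x
    have "continuous_on {0..t} (\<lambda>s. T s x)"
      using semigroup unfolding strongly_continuous_semigroup_def
      by (metis atLeastAtMost_iff atLeast_iff continuous_on_subset subsetI)
    then have "bounded ((\<lambda>s. T s x) ` {0..t})"
      by (intro compact_imp_bounded compact_continuous_image) auto
    then show "\<exists>K. \<forall>s\<in>{0..t}. norm (T s x) \<le> K" by (auto simp: bounded_iff)
  qed (auto simp: bounded_linear_T)
  then obtain K where K: "K \<ge> 0" "\<And>s x. 0 \<le> s \<Longrightarrow> s \<le> t \<Longrightarrow> norm (T s x) \<le> K * norm x" by auto
  then have "norm (S s x) \<le> K * norm x" if "0 \<le> s" "s \<le> t" for s x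
    unfolding S_def using that by (intro bounded_linear_adjoint(2) bounded_linear_T) auto
  with K that show thesis by blast
qed

lemma \<phi>_diff: "s \<ge> 0 \<Longrightarrow> h \<ge> 0 \<Longrightarrow> \<phi> a (s + h) - \<phi> a s = \<phi> (S s a) h"
  using cocycle[of h s a] by (simp add: \<phi>_def S_def add.commute)

text \<open>Both sides equal \<open>\<phi> (S (r + s) a) h\<close>. This transport of increments
  drives the trace estimate, the passage to the density and the skew equation.\<close>

lemma \<phi>_shift:
  "s \<ge> 0 \<Longrightarrow> r \<ge> 0 \<Longrightarrow> h \<ge> 0 \<Longrightarrow>
     \<phi> a (r + s + h) - \<phi> a (r + s) = \<phi> (S r a) (s + h) - \<phi> (S r a) s"
  using \<phi>_diff[of "r + s" h a] \<phi>_diff[of s h "S r a"] S_add[of r s a] by simp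

lemma \<phi>_0: "\<phi> a 0 = 0"
  using \<phi>_diff[of 0 0 a] by simp

lemma \<phi>_nonneg: "t \<ge> 0 \<Longrightarrow> \<phi> a t \<ge> 0"
  unfolding \<phi>_def by (rule covariance_operatorD(3)[OF covariance])

lemma \<phi>_mono: "0 \<le> s \<Longrightarrow> s \<le> t \<Longrightarrow> \<phi> a s \<le> \<phi> a t"
  using \<phi>_diff[of s "t - s" a] \<phi>_nonneg[of "t - s" "S s a"] by simp

lemma covariance_increment:
  assumes "s \<ge> 0" "h \<ge> 0"
  shows "covariance_operator (\<lambda>a. R (s + h) a - R s a)"
  unfolding covariance_operator_def
proof (intro conjI)
  have R: "covariance_operator (R (s + h))" "covariance_operator (R s)"
    using assms covariance by auto
  show "bounded_linear (\<lambda>a. R (s + h) a - R s a)"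
    by (intro bounded_linear_sub covariance_operatorD(1) R)
  show "symmetric_operator (\<lambda>a. R (s + h) a - R s a)"
    by (simp add: symmetric_operator_def inner_diff covariance_operatorD(2)[OF R(1)] covariance_operatorD(2)[OF R(2)])
  show "positive_operator (\<lambda>a. R (s + h) a - R s a)"
    using \<phi>_mono[of s "s + h"] assms by (simp add: positive_operator_def inner_diff \<phi>_def)
qed

text \<open>Each term <S_r a, x_k> = <a, T_r x_k> is continuous in r. The factorization of A makes
  the form a series of their squares, dominated on [0, b] by multiples of |x_k|^2.\<close>

lemma continuous_on_form_S:
  assumes A: "covariance_operator A" and C: "trace_le A C"
  shows "continuous_on {0..} (\<lambda>r. A (S r a) \<bullet> S r a)"
proof (rule continuous_on_atLeastI)
  fix b :: real
  obtain K where K: "K \<ge> 0" "\<And>s x. 0 \<le> s \<Longrightarrow> s \<le> b \<Longrightarrow> norm (S s x) \<le> K * norm x"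
    using T_locally_bounded[of b] by metis
  from covariance_factorization[OF A C] obtain x where x:
    "summable (\<lambda>n. (norm (x n))\<^sup>2)" "\<And>a. (\<lambda>n. (a \<bullet> x n)\<^sup>2) sums (A a \<bullet> a)" by metis
  have "uniform_limit {0..b} (\<lambda>n r. \<Sum>k<n. (S r a \<bullet> x k)\<^sup>2) (\<lambda>r. \<Sum>k. (S r a \<bullet> x k)\<^sup>2) sequentially"
  proof (rule Weierstrass_m_test)
    show "summable (\<lambda>n. (K * norm a)\<^sup>2 * (norm (x n))\<^sup>2)" using x(1) by (rule summable_mult)
    fix n r assume r: "r \<in> {0..b}"
    have "\<bar>S r a \<bullet> x n\<bar> \<le> norm (S r a) * norm (x n)" by (rule Cauchy_Schwarz_ineq2)
    also have "\<dots> \<le> K * norm a * norm (x n)" using r by (intro mult_right_mono K) auto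
    finally have "\<bar>S r a \<bullet> x n\<bar>\<^sup>2 \<le> (K * norm a * norm (x n))\<^sup>2" by (intro power_mono) auto
    then show "norm ((S r a \<bullet> x n)\<^sup>2) \<le> (K * norm a)\<^sup>2 * (norm (x n))\<^sup>2"
      by (simp add: power_mult_distrib)
  qed
  moreover have "continuous_on {0..b} (\<lambda>r. \<Sum>k<n. (S r a \<bullet> x k)\<^sup>2)" for n
  proof -
    have "continuous_on {0..b} (\<lambda>r. S r a \<bullet> x k)" for k
    proof (rule continuous_on_cong[THEN iffD1])
      have "continuous_on {0..b} (\<lambda>r. T r (x k))"
        using semigroup unfolding strongly_continuous_semigroup_def
        by (metis atLeastAtMost_iff atLeast_iff continuous_on_subset subsetI)
      then show "continuous_on {0..b} (\<lambda>r. T r (x k) \<bullet> a)" by (intro continuous_intros)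
      show "T r (x k) \<bullet> a = S r a \<bullet> x k" if "r \<in> {0..b}" for r
        using that inner_S[of r "x k" a] by (simp add: inner_commute)
    qed auto
    then show ?thesis by (intro continuous_on_sum continuous_on_power)
  qed
  ultimately have "continuous_on {0..b} (\<lambda>r. \<Sum>k. (S r a \<bullet> x k)\<^sup>2)"
    by (intro uniform_limit_theorem) (auto simp: eventually_sequentially)
  then show "continuous_on {0..b} (\<lambda>r. A (S r a) \<bullet> S r a)"
    using x(2) by (simp add: sums_iff)
qed

text \<open>
  For \<open>k h \<le> \<epsilon> \<le> s\<close> the increment of \<open>R\<close> over \<open>[s, s + h]\<close> is the increment over
  \<open>[k h, (k + 1) h]\<close> transported by \<open>T\<^bsub>s - k h\<^esub>\<close>. Summation over \<open>k\<close> telescopes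
  to the trace of \<open>R\<^bsub>\<epsilon>\<^esub>\<close>.
\<close>

lemma increment_trace_le:
  assumes "\<epsilon> > 0"
  obtains L where "L \<ge> 0"
    "\<And>s h. \<epsilon> \<le> s \<Longrightarrow> s \<le> t \<Longrightarrow> 0 < h \<Longrightarrow> h \<le> \<epsilon> / 2 \<Longrightarrow>
       trace_le (\<lambda>a. R (s + h) a - R s a) (L * h)"
proof -
  obtain K where K: "K \<ge> 0" "\<And>s x. 0 \<le> s \<Longrightarrow> s \<le> t \<Longrightarrow> norm (T s x) \<le> K * norm x"
    using T_locally_bounded[of t] by metis
  \<comment> \<open>The trace of R_s along the basis.\<close>
  define g where "g s = (\<Sum>m. \<phi> (e m) s)" for s
  have sm: "summable (\<lambda>m. \<phi> (e m) s)" if s: "s \<ge> 0" for s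
  proof -
    obtain C where "trace_le (R s) C" using finite_trace[OF s] by blast
    then show ?thesis
      using \<phi>_nonneg[OF s] by (intro summableI_nonneg_bounded) (auto simp: trace_le_def \<phi>_def)
  qed
  have g_mono: "g s \<le> g u" if "0 \<le> s" "s \<le> u" for s u
    unfolding g_def using that by (intro suminf_le sm \<phi>_mono) auto
  have g_nonneg: "g s \<ge> 0" if "s \<ge> 0" for s
    unfolding g_def using that by (intro suminf_nonneg sm \<phi>_nonneg) auto
  \<comment> \<open>K^2 comes from the conjugation by T, \<open>g \<epsilon>\<close> from the
    telescoped sum, and 2/\<epsilon> from N >= \<epsilon>/(2h).\<close>
  define L where "L = 2 * K\<^sup>2 * g \<epsilon> / \<epsilon>"
  have "trace_le (\<lambda>a. R (s + h) a - R s a) (L * h)"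
    if s: "\<epsilon> \<le> s" "s \<le> t" and h: "0 < h" "h \<le> \<epsilon> / 2" for s h
    unfolding trace_le_def
  proof
    fix M
    define X where "X = (\<Sum>m<M. (R (s + h) (e m) - R s (e m)) \<bullet> e m)"
    define N where "N = nat \<lfloor>\<epsilon> / h\<rfloor>"
    have N: "real N \<le> \<epsilon> / h" "real N > \<epsilon> / h - 1"
      unfolding N_def using assms h(1) by (auto simp: of_nat_nat)
    then have Nh: "real N * h \<le> \<epsilon>" using h(1) by (simp add: field_simps)
    \<comment> \<open>The condition h <= \<epsilon>/2 ensures that rounding \<epsilon>/h down loses
      at most half of it.\<close>
    have "\<epsilon> / (2 * h) \<ge> 1" using h by (simp add: field_simps)
    then have N': "real N \<ge> \<epsilon> / (2 * h)" "N > 0" using N by (auto simp: field_simps)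
    have X: "X \<le> K\<^sup>2 * (g (real (Suc k) * h) - g (real k * h))" if "k < N" for k
    proof -
      define D where "D a = R (real k * h + h) a - R (real k * h) a" for a
      have "real k * h \<le> real N * h" using that h(1) by (intro mult_right_mono) auto
      with Nh s(1) have "real k * h \<le> s" by linarith
      with h(1) have kh: "real k * h \<ge> 0" "real k * h \<le> s" by auto
      have D: "covariance_operator D"
        unfolding D_def using kh(1) h(1) by (intro covariance_increment) auto
      have s_kh: "0 \<le> s - real k * h" "s - real k * h \<le> t" using kh s by linarith+
      have D_trace: "trace_le D (g (real (Suc k) * h) - g (real k * h))"
        unfolding trace_le_def
      proof
        fix n
        have k1: "real (Suc k) * h = real k * h + h" by (simp add: algebra_simps)
        have "(\<Sum>m<n. D (e m) \<bullet> e m) = (\<Sum>m<n. \<phi> (e m) (real (Suc k) * h) - \<phi> (e m) (real k * h))"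
          unfolding k1 by (simp add: D_def \<phi>_def inner_diff_left)
        also have "\<dots> \<le> (\<Sum>m. \<phi> (e m) (real (Suc k) * h) - \<phi> (e m) (real k * h))"
          using kh h(1) unfolding k1
          by (intro sum_le_suminf summable_diff sm) (auto simp: \<phi>_mono)
        also have "\<dots> = g (real (Suc k) * h) - g (real k * h)"
          unfolding g_def using h(1) by (intro suminf_diff[symmetric] sm) auto
        finally show "(\<Sum>m<n. D (e m) \<bullet> e m) \<le> g (real (Suc k) * h) - g (real k * h)" .
      qed
      have "trace_le (\<lambda>a. T (s - k * h) (D (adjoint (T (s - k * h)) a)))
          (K\<^sup>2 * (g (real (Suc k) * h) - g (real k * h)))"
        by (intro trace_le_conjugate[OF D D_trace] K(2) bounded_linear_T s_kh)
      \<comment> \<open>\<open>\<phi>_shift\<close> with transport time s - kh; equality of the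
        quadratic forms suffices, as the trace uses diagonal entries only.\<close>
      moreover have "(R (s + h) a - R s a) \<bullet> a = T (s - k * h) (D (adjoint (T (s - k * h)) a)) \<bullet> a" for a
      proof -
        have "T (s - k * h) (D (adjoint (T (s - k * h)) a)) \<bullet> a = D (S (s - k * h) a) \<bullet> S (s - k * h) a"
          unfolding S_def using kh by (intro covariance_conjugate(2)[OF D] bounded_linear_T) auto
        then show ?thesis
          using \<phi>_shift[of "real k * h" "s - real k * h" h a] kh h(1)
          by (simp add: D_def \<phi>_def inner_diff_left)
      qed
      ultimately show ?thesis by (simp add: X_def trace_le_def)
    qed
    have "real N * X = (\<Sum>k<N. X)" by simp
    also have "\<dots> \<le> (\<Sum>k<N. K\<^sup>2 * (g (real (Suc k) * h) - g (real k * h)))"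
      using X by (intro sum_mono) auto
    also have "\<dots> = K\<^sup>2 * (g (real N * h) - g 0)"
      unfolding sum_distrib_left[symmetric]
      using sum_lessThan_telescope[of "\<lambda>k. g (real k * h)" N] by simp
    also have "\<dots> \<le> K\<^sup>2 * g \<epsilon>"
      using g_mono[OF _ Nh] g_nonneg[of 0] h(1) by (intro mult_left_mono) auto
    finally have NX: "real N * X \<le> K\<^sup>2 * g \<epsilon>" .
    have "X \<ge> 0"
      unfolding X_def using covariance_operatorD(3)[OF covariance_increment[of s h]] s h assms
      by (intro sum_nonneg) auto
    then have "\<epsilon> / (2 * h) * X \<le> real N * X" using N'(1) by (rule mult_right_mono[rotated])
    with NX have "\<epsilon> / (2 * h) * X \<le> K\<^sup>2 * g \<epsilon>" by linarith
    then show "X \<le> L * h" using assms h(1) by (simp add: L_def field_simps)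
  qed
  moreover have "L \<ge> 0" unfolding L_def using assms g_nonneg[of \<epsilon>] by simp
  ultimately show thesis using that by blast
qed

text \<open>The form of an increment is at most its trace times |a|^2, so the trace estimate makes
  \<phi> Lipschitz near s.\<close>

lemma \<phi>_isCont:
  assumes "s > 0"
  shows "isCont (\<phi> a) s"
proof -
  \<comment> \<open>The lower end s/2 leaves room for increments that start to the left of
    s.\<close>
  obtain L where L: "L \<ge> 0" "\<And>u h. s / 2 \<le> u \<Longrightarrow> u \<le> s + 1 \<Longrightarrow> 0 < h \<Longrightarrow> h \<le> s / 2 / 2 \<Longrightarrow>
       trace_le (\<lambda>a. R (u + h) a - R u a) (L * h)"
    by (rule increment_trace_le[of "s / 2" "s + 1"]) (use assms in auto)
  have step: "\<bar>\<phi> a v - \<phi> a u\<bar> \<le> L * (norm a)\<^sup>2 * (v - u)"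
    if "s / 2 \<le> u" "u \<le> s + 1" "u \<le> v" "v - u \<le> s / 4" for u v
  proof (cases "u = v")
    case False
    then have "trace_le (\<lambda>a. R v a - R u a) (L * (v - u))" using L(2)[of u "v - u"] that by simp
    moreover have "covariance_operator (\<lambda>a. R v a - R u a)"
      using covariance_increment[of u "v - u"] that assms by simp
    ultimately have "(R v a - R u a) \<bullet> a \<le> L * (v - u) * (norm a)\<^sup>2" by (intro covariance_form_le)
    then show ?thesis
      using \<phi>_mono[of u v a] that assms by (simp add: \<phi>_def inner_diff_left mult_ac)
  qed simp
  have "\<forall>\<^sub>F x in at s. norm (\<phi> a x - \<phi> a s) \<le> L * (norm a)\<^sup>2 * \<bar>x - s\<bar>"
  proof -
    define d where "d = min 1 (s / 4)"
    have d: "d > 0" "d \<le> 1" "d \<le> s / 4" using assms by (auto simp: d_def)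
    have "norm (\<phi> a x - \<phi> a s) \<le> L * (norm a)\<^sup>2 * \<bar>x - s\<bar>" if "dist x s < d" for x
    proof (cases "s \<le> x")
      case True
      then show ?thesis using step[of s x] that d assms by (simp add: dist_real_def)
    next
      case False
      then show ?thesis using step[of x s] that d assms by (simp add: dist_real_def abs_minus_commute)
    qed
    then show ?thesis using d(1) unfolding eventually_at by blast
  qed
  moreover have "((\<lambda>x. L * (norm a)\<^sup>2 * \<bar>x - s\<bar>) \<longlongrightarrow> 0) (at s)"
    by (rule tendsto_eq_intros refl)+ simp
  ultimately show ?thesis
    unfolding isCont_def by (rule LIM_zero_cancel[OF Lim_null_comparison])
qed

text \<open>A jump of \<open>R\<close> at \<open>0\<close> would be repeated at \<open>1\<close>, where \<open>R\<close> is continuous.\<close>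

lemma \<phi>_tendsto_0: "(\<phi> a \<longlongrightarrow> 0) (at_right 0)"
proof -
  obtain C where C: "trace_le (R 1) C" using finite_trace[of 1] by auto
  have "continuous_on {0..} (\<lambda>r. R 1 (S r a) \<bullet> S r a)"
    by (rule continuous_on_form_S[OF covariance C]) simp
  then have "((\<lambda>r. R 1 (S r a) \<bullet> S r a) \<longlongrightarrow> \<phi> a 1) (at_right 0)"
    by (auto simp: continuous_on_def \<phi>_def elim!: ballE[of _ _ 0] intro: tendsto_within_subset)
  moreover have "((\<lambda>r. \<phi> a (1 + r)) \<longlongrightarrow> \<phi> a 1) (at_right 0)"
  proof -
    have "((\<lambda>r. 1 + r) \<longlongrightarrow> 1) (at_right (0::real))" by (rule tendsto_eq_intros refl)+ simp
    then show ?thesis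
      by (rule isCont_tendsto_compose[where g = "\<phi> a", OF \<phi>_isCont[OF zero_less_one]])
  qed
  \<comment> \<open>By the cocycle identity for times 1 and r this difference is exactly
    \<open>\<phi> a r\<close>.\<close>
  ultimately have "((\<lambda>r. \<phi> a (1 + r) - R 1 (S r a) \<bullet> S r a) \<longlongrightarrow> \<phi> a 1 - \<phi> a 1) (at_right 0)"
    by (intro tendsto_diff)
  then have "((\<lambda>r. \<phi> a (1 + r) - R 1 (S r a) \<bullet> S r a) \<longlongrightarrow> 0) (at_right 0)" by simp
  then show ?thesis
  proof (rule Lim_transform_eventually)
    show "\<forall>\<^sub>F r in at_right 0. \<phi> a (1 + r) - R 1 (S r a) \<bullet> S r a = \<phi> a r"
      using cocycle[of 1 _ a] by (auto simp: eventually_at_right_field \<phi>_def S_def intro!: exI[of _ 1])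
  qed
qed

text \<open>The difference quotient of \<phi> at a later time \<rho> is that of R at s evaluated at
  \<open>S (\<rho> - s) a\<close>. One weak limit taken at s thus serves all \<rho> >= s and all
  a.\<close>

lemma density_exists:
  assumes "s > 0"
  obtains U C where "covariance_operator U" "trace_le U C"
    "\<And>a t. t \<ge> s \<Longrightarrow> integral {s..t} (\<lambda>\<rho>. U (S (\<rho> - s) a) \<bullet> S (\<rho> - s) a) = \<phi> a t - \<phi> a s"
proof -
  \<comment> \<open>Only increments that start at s itself matter, so both parameters are s; the
    steps \<open>h n\<close> below stay in the admissible range up to s/2.\<close>
  obtain L where L: "L \<ge> 0"
    "\<And>u h. s \<le> u \<Longrightarrow> u \<le> s \<Longrightarrow> 0 < h \<Longrightarrow> h \<le> s / 2 \<Longrightarrow>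
       trace_le (\<lambda>a. R (u + h) a - R u a) (L * h)"
    by (rule increment_trace_le[OF assms, of s]) auto
  define h where "h n = s / 2 * inverse (real (Suc n))" for n
  have h: "h n > 0" "h n \<le> s / 2" for n
    using assms by (auto simp: h_def field_simps)
  have h0: "h \<longlonglongrightarrow> 0"
    unfolding h_def using tendsto_mult_right_zero[OF LIMSEQ_inverse_real_of_nat] by simp
  define A where "A n a = (1 / h n) *\<^sub>R (R (s + h n) a - R s a)" for n a
  have A_cov: "covariance_operator (A n)" for n
  proof -
    have *: "covariance_operator (\<lambda>a. R (s + h n) a - R s a)"
      using assms h(1)[of n] by (intro covariance_increment) auto
    show ?thesis
      unfolding covariance_operator_def A_def
    proof (intro conjI)
      show "bounded_linear (\<lambda>a. (1 / h n) *\<^sub>R (R (s + h n) a - R s a))"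
        by (intro bounded_linear_compose[OF bounded_linear_scaleR_right] covariance_operatorD(1)[OF *])
      show "symmetric_operator (\<lambda>a. (1 / h n) *\<^sub>R (R (s + h n) a - R s a))"
        using covariance_operatorD(2)[OF *] by (simp add: symmetric_operator_def)
      show "positive_operator (\<lambda>a. (1 / h n) *\<^sub>R (R (s + h n) a - R s a))"
        using covariance_operatorD(3)[OF *] h(1)[of n] by (simp add: positive_operator_def)
    qed
  qed
  have A_trace: "trace_le (A n) L" for n
    using L(2)[OF order_refl order_refl h[of n]] h(1)[of n]
    by (auto simp: trace_le_def A_def sum_divide_distrib[symmetric] divide_le_eq)
  obtain r U where r: "strict_mono r" and U: "covariance_operator U" "trace_le U L"
    and lim: "\<And>a b. (\<lambda>n. A (r n) a \<bullet> b) \<longlonglongrightarrow> U a \<bullet> b"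
    by (rule covariance_weak_compactness[where A = A and C = L, OF A_cov A_trace]) auto
  have "integral {s..t} (\<lambda>\<rho>. U (S (\<rho> - s) a) \<bullet> S (\<rho> - s) a) = \<phi> a t - \<phi> a s"
    if "t \<ge> s" for a t
  proof -
    obtain K where K: "K \<ge> 0" "\<And>s x. 0 \<le> s \<Longrightarrow> s \<le> t \<Longrightarrow> norm (S s x) \<le> K * norm x"
      using T_locally_bounded[of t] by metis
    define f where "f k \<rho> = (\<phi> a (\<rho> + h (r k)) - \<phi> a \<rho>) / h (r k)" for k \<rho>
    have f: "f k \<rho> = A (r k) (S (\<rho> - s) a) \<bullet> S (\<rho> - s) a" if "\<rho> \<ge> s" for k \<rho>
      using \<phi>_shift[of s "\<rho> - s" "h (r k)" a] that assms h(1)[of "r k"]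
      by (simp add: f_def A_def \<phi>_def inner_diff_left less_imp_le)
    have cont: "continuous_on {s..} (\<phi> a)"
      using assms \<phi>_isCont by (intro continuous_at_imp_continuous_on) auto
    have "(\<lambda>k. integral {s..t} (f k)) \<longlonglongrightarrow> integral {s..t} (\<lambda>\<rho>. U (S (\<rho> - s) a) \<bullet> S (\<rho> - s) a)"
    proof (rule dominated_convergence(2))
      show "f k integrable_on {s..t}" for k
      proof (rule integrable_continuous_interval)
        have "continuous_on {s..t} (\<lambda>\<rho>. \<phi> a (\<rho> + h (r k)))"
          by (rule continuous_on_compose2[OF cont])
             (use h(1)[of "r k"] in \<open>auto intro!: continuous_intros\<close>)
        moreover have "continuous_on {s..t} (\<phi> a)" by (rule continuous_on_subset[OF cont]) auto
        ultimately show "continuous_on {s..t} (f k)"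
          unfolding f_def using h(1)[of "r k"] by (intro continuous_intros) auto
      qed
      show "(\<lambda>_. L * (K * norm a)\<^sup>2) integrable_on {s..t}" by (rule integrable_const_ivl)
      fix \<rho> assume \<rho>: "\<rho> \<in> {s..t}"
      show "norm (f k \<rho>) \<le> L * (K * norm a)\<^sup>2" for k
      proof -
        have "f k \<rho> \<le> L * (norm (S (\<rho> - s) a))\<^sup>2"
          using f[of \<rho> k] covariance_form_le[OF A_cov A_trace] \<rho> by simp
        also have "\<dots> \<le> L * (K * norm a)\<^sup>2"
          using \<rho> assms L(1) by (intro mult_left_mono power_mono K) auto
        finally show ?thesis
          using f[of \<rho> k] covariance_operatorD(3)[OF A_cov] \<rho> by simp
      qed
      show "(\<lambda>k. f k \<rho>) \<longlonglongrightarrow> U (S (\<rho> - s) a) \<bullet> S (\<rho> - s) a"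
        using f[of \<rho>] lim \<rho> by simp
    qed
    moreover have "(\<lambda>k. integral {s..t} (f k)) \<longlonglongrightarrow> \<phi> a t - \<phi> a s"
      unfolding f_def using h(1) LIMSEQ_subseq_LIMSEQ[OF h0 r]
      by (intro integral_difference_quotient_tendsto cont that) (auto simp: o_def)
    ultimately show ?thesis by (rule LIMSEQ_unique)
  qed
  with U that show thesis by blast
qed

lemma cont_form_S_shift:
  assumes "covariance_operator A" "trace_le A C"
  shows "continuous_on {s..} (\<lambda>\<rho>. A (S (\<rho> - s) a) \<bullet> S (\<rho> - s) a)"
  by (rule continuous_on_compose2[OF continuous_on_form_S[OF assms, of a]])
     (auto intro!: continuous_intros)

theorem skew_density_exists:
  "\<exists>U. (\<forall>s>0. covariance_operator (U s) \<and> (\<exists>C. trace_le (U s) C)) \<and>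
       (\<forall>s>0. \<forall>t>0. U (s + t) = T t \<circ> U s \<circ> adjoint (T t)) \<and>
       (\<forall>t>0. \<forall>a. set_integrable lborel {0<..t} (\<lambda>s. U s a \<bullet> a) \<and>
          R t a \<bullet> a = (LINT s:{0<..t}|lborel. U s a \<bullet> a)) \<and>
       (\<forall>t>0. set_integrable lborel {0<..t} (\<lambda>s. \<Sum>m. U s (e m) \<bullet> e m))"
proof -
  have "\<forall>s\<in>{0<..}. \<exists>U. \<exists>C. covariance_operator U \<and> trace_le U C \<and>
    (\<forall>a. \<forall>t\<ge>s. integral {s..t} (\<lambda>\<rho>. U (S (\<rho> - s) a) \<bullet> S (\<rho> - s) a) = \<phi> a t - \<phi> a s)"
  proof
    fix s :: real assume "s \<in> {0<..}"
    then have "s > 0" by simp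
    then obtain U C where "covariance_operator U" "trace_le U C"
      "\<And>a t. t \<ge> s \<Longrightarrow> integral {s..t} (\<lambda>\<rho>. U (S (\<rho> - s) a) \<bullet> S (\<rho> - s) a) = \<phi> a t - \<phi> a s"
      by (rule density_exists) auto
    then show "\<exists>U. \<exists>C. covariance_operator U \<and> trace_le U C \<and>
      (\<forall>a. \<forall>t\<ge>s. integral {s..t} (\<lambda>\<rho>. U (S (\<rho> - s) a) \<bullet> S (\<rho> - s) a) = \<phi> a t - \<phi> a s)"
      by blast
  qed
  then obtain U where UC: "\<forall>s\<in>{0<..}. \<exists>C. covariance_operator (U s) \<and> trace_le (U s) C \<and>
    (\<forall>a. \<forall>t\<ge>s. integral {s..t} (\<lambda>\<rho>. U s (S (\<rho> - s) a) \<bullet> S (\<rho> - s) a) = \<phi> a t - \<phi> a s)"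
    by (auto dest!: bchoice)
  then obtain C where UC: "\<forall>s\<in>{0<..}. covariance_operator (U s) \<and> trace_le (U s) (C s) \<and>
    (\<forall>a. \<forall>t\<ge>s. integral {s..t} (\<lambda>\<rho>. U s (S (\<rho> - s) a) \<bullet> S (\<rho> - s) a) = \<phi> a t - \<phi> a s)"
    unfolding bchoice_iff by (elim exE)
  have U: "covariance_operator (U s)" and C: "trace_le (U s) (C s)" if "s > 0" for s
    using UC that by auto
  have int: "integral {s..t} (\<lambda>\<rho>. U s (S (\<rho> - s) a) \<bullet> S (\<rho> - s) a) = \<phi> a t - \<phi> a s"
    if "s > 0" "t \<ge> s" for s a t
    using UC that by auto
  have deriv: "((\<lambda>h. (\<phi> a (s + h) - \<phi> a s) / h) \<longlongrightarrow> U s a \<bullet> a) (at_right 0)" if "s > 0" for s a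
    using integral_right_derivative(1)[OF cont_form_S_shift[OF U C] int] that by simp
  \<comment> \<open>Two computations of one right derivative: \<phi> at a near s + t has the same
    increments as \<phi> at S_t a near s. The case t = 0 is included so that \<open>u\<close> covers
    \<rho> = s.\<close>
  have form: "U (s + t) a \<bullet> a = U s (S t a) \<bullet> S t a" if "s > 0" "t \<ge> 0" for s t a
  proof (rule tendsto_unique[OF _ deriv])
    show "((\<lambda>h. (\<phi> a (s + t + h) - \<phi> a (s + t)) / h) \<longlongrightarrow> U s (S t a) \<bullet> S t a) (at_right 0)"
    proof (rule Lim_transform_eventually[OF deriv[OF that(1), of "S t a"]])
      show "\<forall>\<^sub>F h in at_right 0. (\<phi> (S t a) (s + h) - \<phi> (S t a) s) / h = (\<phi> a (s + t + h) - \<phi> a (s + t)) / h"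
        using \<phi>_shift[of s t _ a] that
        by (auto simp: eventually_at_right_field add.commute intro!: exI[of _ 1])
    qed
  qed (use that in auto)
  have skew: "U (s + t) = T t \<circ> U s \<circ> adjoint (T t)" if "s > 0" "t > 0" for s t
  proof (rule covariance_eqI)
    have "covariance_operator (\<lambda>a. T t (U s (adjoint (T t) a)))"
      using that by (intro covariance_conjugate(1) U bounded_linear_T) auto
    then have "covariance_operator (T t \<circ> U s \<circ> adjoint (T t))" by (simp add: o_def)
    then show "bounded_linear (T t \<circ> U s \<circ> adjoint (T t))"
      "symmetric_operator (T t \<circ> U s \<circ> adjoint (T t))"
      by (auto simp: covariance_operator_def)
    show "bounded_linear (U (s + t))" "symmetric_operator (U (s + t))"
      using U[of "s + t"] that by (auto simp: covariance_operator_def)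
    show "U (s + t) a \<bullet> a = (T t \<circ> U s \<circ> adjoint (T t)) a \<bullet> a" for a
      using form[of s t a] that covariance_conjugate(2)[OF U bounded_linear_T, of s t a a] by (simp add: S_def)
  qed
  define u where "u a s = U s a \<bullet> a" for a s
  have u: "u a \<rho> = U s (S (\<rho> - s) a) \<bullet> S (\<rho> - s) a" if "s > 0" "\<rho> \<ge> s" for a s \<rho>
    using form[of s "\<rho> - s" a] that by (simp add: u_def)
  have u_nonneg: "u a s \<ge> 0" if "s > 0" for a s
    unfolding u_def by (rule covariance_operatorD(3)[OF U[OF that]])
  \<comment> \<open>A single operator U_s describes the whole density to the right of s, so its
    continuity is that of the form along S.\<close>
  have u_cont: "continuous_on {s..} (u a)" if "s > 0" for s a
    by (rule continuous_on_eq[OF cont_form_S_shift[OF U[OF that] C[OF that], where a = a and s = s]])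
       (use u that in auto)
  have u_isCont: "isCont (u a) x" if "x > 0" for a x
  proof -
    have "continuous_on {x / 2<..} (u a)" using that by (intro continuous_on_subset[OF u_cont[of "x / 2"]]) auto
    then show ?thesis using that by (auto simp: continuous_on_eq_continuous_at)
  qed
  \<comment> \<open>Base point x/2 makes x interior, which upgrades the right derivative to a
    two-sided one.\<close>
  have \<phi>_deriv: "(\<phi> a has_real_derivative u a x) (at x)" if "x > 0" for a x
  proof (rule integral_right_derivative(2)[where s = "x / 2"])
    show "continuous_on {x / 2..} (u a)" using that by (intro u_cont) simp
    show "integral {x / 2..t} (u a) = \<phi> a t - \<phi> a (x / 2)" if "t \<ge> x / 2" for t
      using int[of "x / 2" t a] u[of "x / 2" _ a] \<open>x > 0\<close> that
      by (metis (mono_tags, lifting) atLeastAtMost_iff half_gt_zero integral_cong)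
  qed (use that in auto)
  have FTC: "set_integrable lborel {0<..t} (u a)" "(LINT s:{0<..t}|lborel. u a s) = \<phi> a t"
    if "t > 0" for a t
  proof -
    have A: "((\<phi> a \<circ> real_of_ereal) \<longlongrightarrow> 0) (at_right (ereal 0))"
      using \<phi>_tendsto_0[of a] by (simp add: ereal_tendsto_simps)
    have B: "((\<phi> a \<circ> real_of_ereal) \<longlongrightarrow> \<phi> a t) (at_left (ereal t))"
      using \<phi>_isCont[OF that, of a] by (auto simp: ereal_tendsto_simps isCont_def intro: tendsto_within_subset)
    \<comment> \<open>The density may be unbounded at 0; its nonnegativity and the limit 0 of \<phi>
      there give integrability and the value of the integral together.\<close>
    have 1: "set_integrable lborel (einterval (ereal 0) (ereal t)) (u a)"
      and 2: "(LBINT x=ereal 0..ereal t. u a x) = \<phi> a t - 0"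
      by (rule interval_integral_FTC_nonneg[where F = "\<phi> a", OF _ _ _ _ A B];
          use that u_nonneg u_isCont \<phi>_deriv in auto)+
    have Ioc: "{0<..t} = {0<..<t} \<union> {t}" using that by auto
    have sing: "set_integrable lborel {t} (u a)"
    proof -
      have "(\<lambda>x. indicator {t} x *\<^sub>R u a x) = (\<lambda>x. u a t * indicator {t} x)"
        by (auto simp: indicator_def)
      then show ?thesis by (simp add: set_integrable_def integrable_real_indicator)
    qed
    show "set_integrable lborel {0<..t} (u a)"
      unfolding Ioc using 1 sing by (intro set_integrable_Un) auto
    show "(LINT s:{0<..t}|lborel. u a s) = \<phi> a t"
      using 2 that by (simp add: interval_integral_Ioc)
  qed
  \<comment> \<open>Termwise integration: the integrals of <U_s e_m, e_m> are <R_t e_m, e_m>, whose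
    partial sums are bounded by the trace bound of R_t.\<close>
  have "set_integrable lborel {0<..t} (\<lambda>s. \<Sum>m. u (e m) s)" if t: "t > 0" for t
  proof -
    obtain D where D: "trace_le (R t) D" using finite_trace[of t] t by auto
    define w where "w m s = indicator {0<..t} s * u (e m) s" for m s
    have w: "integrable lborel (w m)" "integral\<^sup>L lborel (w m) = \<phi> (e m) t" for m
      using FTC[OF t, of "e m"] by (simp_all add: w_def[abs_def] set_integrable_def set_lebesgue_integral_def)
    have w_nonneg: "w m s \<ge> 0" for m s
      using u_nonneg by (auto simp: w_def indicator_def)
    have w_summable: "summable (\<lambda>m. w m s)" for s
    proof (cases "s \<in> {0<..t}")
      case True
      then have "(\<Sum>m<n. w m s) \<le> C s" for n
        using C[of s] by (simp add: trace_le_def w_def u_def)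
      then show ?thesis using w_nonneg by (intro summableI_nonneg_bounded)
    qed (simp add: w_def)
    have "integrable lborel (\<lambda>s. \<Sum>m. w m s)"
    proof (rule integrable_suminf)
      show "AE s in lborel. summable (\<lambda>m. norm (w m s))"
        using w_summable w_nonneg by simp
      show "summable (\<lambda>m. LBINT s. norm (w m s))"
      proof (rule summableI_nonneg_bounded)
        show "(\<Sum>m<n. LBINT s. norm (w m s)) \<le> D" for n
          using D w(2) w_nonneg by (simp add: trace_le_def \<phi>_def)
      qed simp
    qed (rule w)
    moreover have "(\<Sum>m. w m s) = indicator {0<..t} s * (\<Sum>m. u (e m) s)" for s
      by (cases "s \<in> {0<..t}") (auto simp: w_def)
    ultimately show ?thesis by (simp add: set_integrable_def)
  qed
  then show ?thesis
    using U C skew FTC by (intro exI[of _ U]) (auto simp: u_def[abs_def] \<phi>_def)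
qed

end

section \<open>Gaussian parts of skew convolution semigroups\<close>

lemma integral_pair_mult:
  fixes f :: "'a \<Rightarrow> complex" and g :: "'b \<Rightarrow> complex"
  assumes "prob_space M" "prob_space N"
    and meas: "f \<in> borel_measurable M" "g \<in> borel_measurable N"
    and bd: "\<And>x. cmod (f x) \<le> 1" "\<And>y. cmod (g y) \<le> 1"
  shows "(CLINT z|M \<Otimes>\<^sub>M N. f (fst z) * g (snd z)) = (CLINT x|M. f x) * (CLINT y|N. g y)"
proof -
  interpret M: prob_space M by fact
  interpret N: prob_space N by fact
  interpret P: pair_prob_space M N ..
  have "integrable (M \<Otimes>\<^sub>M N) (\<lambda>z. f (fst z) * g (snd z))"
  proof (rule P.integrable_const_bound[where B = 1])
    show "(\<lambda>z. f (fst z) * g (snd z)) \<in> borel_measurable (M \<Otimes>\<^sub>M N)"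
      using meas by measurable
    show "AE z in M \<Otimes>\<^sub>M N. cmod (f (fst z) * g (snd z)) \<le> 1"
      using mult_le_one[OF bd(1) norm_ge_zero bd(2)] by (simp add: norm_mult)
  qed
  then have "(CLINT z|M \<Otimes>\<^sub>M N. f (fst z) * g (snd z)) = (CLINT x|M. CLINT y|N. f x * g y)"
    using P.integral_fst'[of "\<lambda>z. f (fst z) * g (snd z)"] by simp
  then show ?thesis by simp
qed

lemma char_functional_conv:
  fixes M N :: "'a::{real_inner, second_countable_topology} measure"
  assumes "prob_space M" "prob_space N" and sets: "sets M = sets borel" "sets N = sets borel"
  shows "char_functional (conv M N) a = char_functional M a * char_functional N a"
proof -
  note meas = measurable_cong_sets[OF sets(1) refl] measurable_cong_sets[OF sets(2) refl]
  have iexp_meas: "(\<lambda>x. iexp (x \<bullet> a)) \<in> borel_measurable borel"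
    by (intro borel_measurable_continuous_onI continuous_intros)
  \<comment> \<open>Second countability identifies the product sigma-algebra with the Borel sets of
    the product space, so continuity of addition suffices.\<close>
  have add: "(\<lambda>(x, y). x + y) \<in> measurable (M \<Otimes>\<^sub>M N) borel"
  proof -
    have "(\<lambda>z. fst z + snd z) \<in> measurable (borel \<Otimes>\<^sub>M borel) (borel :: 'a measure)"
      unfolding borel_prod by (intro borel_measurable_continuous_onI continuous_intros)
    then have "(\<lambda>z. fst z + snd z) \<in> measurable (M \<Otimes>\<^sub>M N) (borel :: 'a measure)"
      by (subst measurable_cong_sets[OF sets_pair_measure_cong[OF sets] refl])
    then show ?thesis by (simp add: case_prod_beta')
  qed
  have "char_functional (conv M N) a = (CLINT z|M \<Otimes>\<^sub>M N. iexp (fst z \<bullet> a) * iexp (snd z \<bullet> a))"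
    unfolding char_functional_def conv_def
    by (subst integral_distr[OF add iexp_meas])
       (simp add: case_prod_beta' inner_add_left exp_add[symmetric] distrib_left)
  also have "\<dots> = char_functional M a * char_functional N a"
    unfolding char_functional_def
    by (rule integral_pair_mult) (use assms iexp_meas in \<open>auto simp: meas\<close>)
  finally show ?thesis .
qed

section \<open>The jump integral along rays\<close>

text \<open>The first bound is an integrable majorant uniform in c, the second gives pointwise
  decay: the two inputs of dominated convergence. In the constant, |a|^2 serves small jumps and 2
  serves large ones.\<close>

lemma levy_kernel_cos_bounds:
  fixes x a :: "'a::real_inner"
  assumes "c \<ge> 1"
  shows "\<bar>cos (c * (x \<bullet> a)) - 1\<bar> / c\<^sup>2 \<le> (2 + (norm a)\<^sup>2) * min 1 ((norm x)\<^sup>2)"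
    and "\<bar>cos (c * (x \<bullet> a)) - 1\<bar> / c\<^sup>2 \<le> 2 / c\<^sup>2"
proof -
  have c: "c\<^sup>2 \<ge> 1" using assms by (simp add: one_le_power)
  have two: "\<bar>cos z - 1\<bar> \<le> 2" for z :: real
    using cos_ge_minus_one[of z] cos_le_one[of z] by linarith
  show *: "\<bar>cos (c * (x \<bullet> a)) - 1\<bar> / c\<^sup>2 \<le> 2 / c\<^sup>2"
    using two by (intro divide_right_mono) auto
  show "\<bar>cos (c * (x \<bullet> a)) - 1\<bar> / c\<^sup>2 \<le> (2 + (norm a)\<^sup>2) * min 1 ((norm x)\<^sup>2)"
  proof (cases "norm x \<le> 1")
    case True
    \<comment> \<open>Half the angle: 1 - cos(2y) = 2 sin(y)^2 <= 2 y^2, so that c^2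
      cancels.\<close>
    define y where "y = c * (x \<bullet> a) / 2"
    have "\<bar>cos (2 * y) - 1\<bar> = 2 * (sin y)\<^sup>2" by (simp add: cos_double_sin)
    also have "\<dots> \<le> 2 * y\<^sup>2"
      using abs_sin_x_le_abs_x[of y] by (simp add: abs_le_square_iff)
    finally have "\<bar>cos (c * (x \<bullet> a)) - 1\<bar> \<le> c\<^sup>2 * (x \<bullet> a)\<^sup>2 / 2"
      by (simp add: y_def power_mult_distrib power_divide)
    then have "\<bar>cos (c * (x \<bullet> a)) - 1\<bar> / c\<^sup>2 \<le> (x \<bullet> a)\<^sup>2 / 2"
      using c by (subst pos_divide_le_eq) (auto simp: mult.commute)
    also have "(x \<bullet> a)\<^sup>2 \<le> (norm a)\<^sup>2 * (norm x)\<^sup>2"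
      using Cauchy_Schwarz_ineq[of x a] by (simp add: power2_norm_eq_inner mult.commute)
    also have "(norm a)\<^sup>2 * (norm x)\<^sup>2 / 2 \<le> (2 + (norm a)\<^sup>2) * (norm x)\<^sup>2"
      by (simp add: algebra_simps)
    also have "(norm x)\<^sup>2 = min 1 ((norm x)\<^sup>2)" using True by (simp add: min_absorb2 power_le_one)
    finally show ?thesis by simp
  next
    case False
    then have m: "min 1 ((norm x)\<^sup>2) = 1" by (simp add: min_def one_le_power)
    have "2 / c\<^sup>2 \<le> 2" using c by (subst pos_divide_le_eq; linarith)
    with * show ?thesis unfolding m by (smt (verit) zero_le_power2)
  qed
qed

text \<open>For |x| <= 1 the compensator cancels the first-order Taylor term and leaves a quadratic
  remainder; for larger x the kernel is bounded by 2.\<close>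

lemma cmod_levy_kernel_le:
  fixes x a :: "'a::real_inner"
  shows "cmod (levy_kernel x a) \<le> (2 + (norm a)\<^sup>2) * min 1 ((norm x)\<^sup>2)"
proof (cases "norm x \<le> 1")
  case True
  have "cmod (iexp (x \<bullet> a) - (\<Sum>k\<le>1. (\<i> * complex_of_real (x \<bullet> a)) ^ k / fact k)) \<le> \<bar>x \<bullet> a\<bar> ^ Suc 1 / fact (Suc 1)"
    by (rule iexp_approx1)
  then have "cmod (levy_kernel x a) \<le> (x \<bullet> a)\<^sup>2 / 2"
    using True by (simp add: levy_kernel_def numeral_2_eq_2 diff_diff_eq)
  also have "(x \<bullet> a)\<^sup>2 \<le> (norm a)\<^sup>2 * (norm x)\<^sup>2"
    using Cauchy_Schwarz_ineq[of x a] by (simp add: power2_norm_eq_inner mult.commute)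
  also have "(norm a)\<^sup>2 * (norm x)\<^sup>2 / 2 \<le> (2 + (norm a)\<^sup>2) * (norm x)\<^sup>2"
    by (simp add: algebra_simps)
  also have "(norm x)\<^sup>2 = min 1 ((norm x)\<^sup>2)" using True by (simp add: min_absorb2 power_le_one)
  finally show ?thesis by simp
next
  case False
  then have m: "min 1 ((norm x)\<^sup>2) = 1" by (simp add: min_def one_le_power)
  have "cmod (levy_kernel x a) = cmod (iexp (x \<bullet> a) - 1)" using False by (simp add: levy_kernel_def)
  also have "\<dots> \<le> 2" using norm_triangle_ineq4[of "iexp (x \<bullet> a)" 1] by simp
  finally show ?thesis unfolding m by (smt (verit) zero_le_power2)
qed

text \<open>The compensator is purely imaginary and drops out.\<close>

lemma Re_levy_kernel: "Re (levy_kernel x a) = cos (x \<bullet> a) - 1"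
  by (simp add: levy_kernel_def Re_exp indicator_def)

context
  fixes M :: "'a::{real_inner, second_countable_topology} measure"
  assumes M: "levy_measure M"
begin

lemma levy_measurable:
  assumes "f \<in> borel_measurable borel"
  shows "f \<in> borel_measurable M"
  using measurable_restrict_space1[OF assms, of "- {0}"] M
  by (simp add: levy_measure_def cong: measurable_cong_sets)

lemma levy_integrable_min: "integrable M (\<lambda>x. min 1 ((norm x)\<^sup>2))"
proof (rule integrableI_nonneg)
  show "(\<lambda>x. min 1 ((norm x)\<^sup>2)) \<in> borel_measurable M"
    by (intro levy_measurable borel_measurable_continuous_onI continuous_intros)
qed (use M in \<open>auto simp: levy_measure_def\<close>)

text \<open>Required before the real part can be moved inside the integral.\<close>

lemma levy_kernel_integrable: "integrable M (\<lambda>x. levy_kernel x a)"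
proof (rule Bochner_Integration.integrable_bound)
  show "integrable M (\<lambda>x. (2 + (norm a)\<^sup>2) * min 1 ((norm x)\<^sup>2))"
    by (intro integrable_mult_right levy_integrable_min)
  have 1: "(\<lambda>x. iexp (x \<bullet> a)) \<in> borel_measurable borel"
    by (intro borel_measurable_continuous_onI continuous_intros)
  have 2: "(\<lambda>x. indicator {0..1} (norm x) :: complex) \<in> borel_measurable (borel :: 'a measure)"
    by measurable
  have 3: "(\<lambda>x. \<i> * complex_of_real (x \<bullet> a)) \<in> borel_measurable borel"
    by (intro borel_measurable_continuous_onI continuous_intros)
  show "(\<lambda>x. levy_kernel x a) \<in> borel_measurable M"
    unfolding levy_kernel_def
    by (rule levy_measurable[OF borel_measurable_diff[OF borel_measurable_diff[OF 1
            borel_measurable_const] borel_measurable_times[OF 3 2]]])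
qed (use cmod_levy_kernel_le in \<open>auto intro!: AE_I2 order_trans[OF cmod_levy_kernel_le]\<close>)

text \<open>Jumps are negligible against the quadratic Gaussian growth. \<open>Suc n\<close> keeps
  the scale at least 1, as the majorant requires.\<close>

lemma levy_integral_scaled_tendsto_0:
  "(\<lambda>n. Re (CLINT x|M. levy_kernel x (real (Suc n) *\<^sub>R a)) / (real (Suc n))\<^sup>2) \<longlonglongrightarrow> 0"
proof -
  have "(\<lambda>n. LINT x|M. (cos (real (Suc n) * (x \<bullet> a)) - 1) / (real (Suc n))\<^sup>2) \<longlonglongrightarrow> (LINT x|M. 0)"
  proof (rule integral_dominated_convergence)
    show "integrable M (\<lambda>x. (2 + (norm a)\<^sup>2) * min 1 ((norm x)\<^sup>2))"
      by (intro integrable_mult_right levy_integrable_min)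
    show "(\<lambda>x. (cos (real (Suc n) * (x \<bullet> a)) - 1) / (real (Suc n))\<^sup>2) \<in> borel_measurable M" for n
      by (intro levy_measurable borel_measurable_continuous_onI continuous_intros) auto
    show "AE x in M. norm ((cos (real (Suc n) * (x \<bullet> a)) - 1) / (real (Suc n))\<^sup>2)
        \<le> (2 + (norm a)\<^sup>2) * min 1 ((norm x)\<^sup>2)" for n
      using levy_kernel_cos_bounds(1)[of "real (Suc n)" _ a] by (intro AE_I2) (simp add: abs_divide)
    have "(\<lambda>n. (cos (real (Suc n) * (x \<bullet> a)) - 1) / (real (Suc n))\<^sup>2) \<longlonglongrightarrow> 0" for x
    proof (rule Lim_null_comparison)
      show "\<forall>\<^sub>F n in sequentially. norm ((cos (real (Suc n) * (x \<bullet> a)) - 1) / (real (Suc n))\<^sup>2)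
          \<le> 2 / (real (Suc n))\<^sup>2"
      proof (intro always_eventually allI)
        show "norm ((cos (real (Suc n) * (x \<bullet> a)) - 1) / (real (Suc n))\<^sup>2) \<le> 2 / (real (Suc n))\<^sup>2" for n
          using levy_kernel_cos_bounds(2)[of "real (Suc n)" x a] by (simp add: abs_divide)
      qed
      have "(\<lambda>n. 2 * (inverse (real (Suc n)))\<^sup>2) \<longlonglongrightarrow> 0"
        using tendsto_mult_left[OF tendsto_power[OF LIMSEQ_inverse_real_of_nat, of 2], of 2] by simp
      then show "(\<lambda>n. 2 / (real (Suc n))\<^sup>2) \<longlonglongrightarrow> 0"
        by (simp only: divide_inverse power_inverse)
    qed
    then show "AE x in M. (\<lambda>n. (cos (real (Suc n) * (x \<bullet> a)) - 1) / (real (Suc n))\<^sup>2) \<longlonglongrightarrow> 0" by simp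
  qed simp
  moreover have "Re (CLINT x|M. levy_kernel x (c *\<^sub>R a)) = (LINT x|M. cos (c * (x \<bullet> a)) - 1)" for c
    using integral_Re[OF levy_kernel_integrable[of "c *\<^sub>R a"]] by (simp add: Re_levy_kernel)
  ultimately show ?thesis by simp
qed

end

text \<open>The modulus discards the drift and makes a real logarithm available, so no branch of the
  complex one is chosen. Nonvanishing lets the logarithm of a product split.\<close>

lemma levy_khintchine_gaussian_part:
  fixes \<mu> :: "'a::{real_inner, second_countable_topology} measure"
  assumes "has_levy_khintchine_triple \<mu> b R M"
  shows "char_functional \<mu> a \<noteq> 0"
    and "(\<lambda>n. ln (cmod (char_functional \<mu> (real (Suc n) *\<^sub>R a))) / (real (Suc n))\<^sup>2)
           \<longlonglongrightarrow> - (R a \<bullet> a) / 2"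
proof -
  have M: "levy_measure M" and R: "bounded_linear R"
    and char: "\<And>a. char_functional \<mu> a =
        exp (\<i> * complex_of_real (b \<bullet> a) - complex_of_real (R a \<bullet> a) / 2 + (CLINT x|M. levy_kernel x a))"
    using assms by (auto simp: has_levy_khintchine_triple_def nuclear_operator_def)
  show "char_functional \<mu> a \<noteq> 0" by (simp add: char)
  have "(\<lambda>n. - (R a \<bullet> a) / 2 + Re (CLINT x|M. levy_kernel x (real (Suc n) *\<^sub>R a)) / (real (Suc n))\<^sup>2)
      \<longlonglongrightarrow> - (R a \<bullet> a) / 2 + 0"
    by (intro tendsto_add tendsto_const levy_integral_scaled_tendsto_0[OF M])
  moreover have "ln (cmod (char_functional \<mu> (c *\<^sub>R a))) / c\<^sup>2
      = - (R a \<bullet> a) / 2 + Re (CLINT x|M. levy_kernel x (c *\<^sub>R a)) / c\<^sup>2" if "c > 0" for c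
  proof -
    have "R (c *\<^sub>R a) \<bullet> (c *\<^sub>R a) = c\<^sup>2 * (R a \<bullet> a)"
      using R by (simp add: linear_simps power2_eq_square)
    then have "ln (cmod (char_functional \<mu> (c *\<^sub>R a)))
        = - (c\<^sup>2 * (R a \<bullet> a)) / 2 + Re (CLINT x|M. levy_kernel x (c *\<^sub>R a))"
      by (simp add: char norm_exp_eq_Re)
    then show ?thesis using that by (simp add: field_simps)
  qed
  ultimately show "(\<lambda>n. ln (cmod (char_functional \<mu> (real (Suc n) *\<^sub>R a))) / (real (Suc n))\<^sup>2)
           \<longlonglongrightarrow> - (R a \<bullet> a) / 2" by simp
qed

text \<open>The log-modulus of the characteristic functional is additive under convolution; dividing
  by n^2 along the ray of a isolates the Gaussian forms. The vector a' plays the role of T_t^* a, so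
  existence of adjoints does not enter.\<close>

lemma SC_semigroup_gaussian_cocycle:
  fixes T :: "real \<Rightarrow> 'a::{real_inner, second_countable_topology} \<Rightarrow> 'a"
  assumes T: "strongly_continuous_semigroup T" and \<mu>: "SC_semigroup T \<mu>"
    and LK: "\<And>t. t \<ge> 0 \<Longrightarrow> has_levy_khintchine_triple (\<mu> t) (b t) (R t) (M t)"
    and rt: "r \<ge> 0" "t \<ge> 0"
    and adj: "\<And>x. T t x \<bullet> a = x \<bullet> a'"
  shows "R (r + t) a \<bullet> a = R r a' \<bullet> a' + R t a \<bullet> a"
proof -
  have \<mu>_prob: "prob_space (\<mu> s)" and \<mu>_sets: "sets (\<mu> s) = sets borel" if "s \<ge> 0" for s
    using \<mu> that by (auto simp: SC_semigroup_def)
  have "bounded_linear (T t)" using T rt by (simp add: strongly_continuous_semigroup_def)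
  then have "T t \<in> borel_measurable borel"
    by (intro borel_measurable_continuous_onI linear_continuous_on)
  then have T_meas: "T t \<in> measurable (\<mu> r) borel"
    using measurable_cong_sets[OF \<mu>_sets[OF rt(1)] refl] by blast
  define F where "F s a = ln (cmod (char_functional (\<mu> s) a))" for s a
  have F: "F (r + t) (c *\<^sub>R a) = F r (c *\<^sub>R a') + F t (c *\<^sub>R a)" for c
  proof -
    have "char_functional (\<mu> (r + t)) (c *\<^sub>R a)
        = char_functional (distr (\<mu> r) borel (T t)) (c *\<^sub>R a) * char_functional (\<mu> t) (c *\<^sub>R a)"
    proof -
      have "\<mu> (r + t) = conv (distr (\<mu> r) borel (T t)) (\<mu> t)"
        using \<mu> rt by (simp add: SC_semigroup_def)
      then show ?thesis
        using \<mu>_prob rt \<mu>_sets prob_space.prob_space_distr[OF \<mu>_prob[OF rt(1)] T_meas]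
        by (simp add: char_functional_conv)
    qed
    also have "char_functional (distr (\<mu> r) borel (T t)) (c *\<^sub>R a) = char_functional (\<mu> r) (c *\<^sub>R a')"
      unfolding char_functional_def
      by (subst integral_distr[OF T_meas])
         (auto simp: adj intro!: borel_measurable_continuous_onI continuous_intros)
    finally show ?thesis
      using levy_khintchine_gaussian_part(1)[OF LK] rt by (simp add: F_def norm_mult ln_mult)
  qed
  have lim: "(\<lambda>n. F s (real (Suc n) *\<^sub>R v) / (real (Suc n))\<^sup>2) \<longlonglongrightarrow> - (R s v \<bullet> v) / 2"
    if "s \<ge> 0" for s v
    unfolding F_def by (rule levy_khintchine_gaussian_part(2)[OF LK[OF that]])
  have "(\<lambda>n. F (r + t) (real (Suc n) *\<^sub>R a) / (real (Suc n))\<^sup>2)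
      \<longlonglongrightarrow> - (R r a' \<bullet> a') / 2 + - (R t a \<bullet> a) / 2"
    unfolding F add_divide_distrib by (intro tendsto_add lim rt)
  from LIMSEQ_unique[OF lim this] show ?thesis using rt by simp
qed

theorem theorem2p1:
  fixes T :: "real \<Rightarrow> 'a::{real_inner, complete_space, second_countable_topology} \<Rightarrow> 'a"
    and \<mu> :: "real \<Rightarrow> 'a measure"
    and b :: "real \<Rightarrow> 'a"
    and R :: "real \<Rightarrow> 'a \<Rightarrow> 'a"
    and M :: "real \<Rightarrow> 'a measure"
  assumes "strongly_continuous_semigroup T"
    and "SC_semigroup T \<mu>"
    and "\<And>t. t \<ge> 0 \<Longrightarrow> has_levy_khintchine_triple (\<mu> t) (b t) (R t) (M t)"
  shows "\<exists>U :: real \<Rightarrow> 'a \<Rightarrow> 'a.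
    (\<forall>s>0. nuclear_operator (U s)) \<and>
    (\<forall>s>0. \<forall>t>0. U (s + t) = T t \<circ> U s \<circ> adjoint (T t)) \<and>
    (\<forall>t\<ge>0. set_integrable lborel {0<..t} (\<lambda>s. operator_trace (U s))) \<and>
    (\<forall>t\<ge>0. \<forall>a. set_integrable lborel {0<..t} (\<lambda>s. U s a \<bullet> a) \<and>
       R t a \<bullet> a = (LINT s:{0<..t}|lborel. U s a \<bullet> a))"
proof -
  \<comment> \<open>The basis selected inside \<open>operator_trace\<close>. Its enumeration e is
    used throughout, so that the trace becomes the series along e.\<close>
  let ?B = "SOME B :: 'a set. orthonormal_basis B"
  have "orthonormal_basis ?B" using orthonormal_basis_exists by (rule someI_ex)
  from orthonormal_basis_sequence[OF this] obtain e where e: "onb_sequence e"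
    and infsum_e: "\<forall>g :: 'a \<Rightarrow> real. g 0 = 0 \<longrightarrow> (\<forall>n. g (e n) \<ge> 0) \<longrightarrow>
      summable (\<lambda>n. g (e n)) \<longrightarrow> infsum g ?B = (\<Sum>n. g (e n))"
    by (elim exE conjE)
  interpret onb_sequence e by (rule e)
  have LK: "nuclear_operator (R t)" "symmetric_operator (R t)" "positive_operator (R t)" if "t \<ge> 0" for t
    using assms(3)[OF that] by (auto simp: has_levy_khintchine_triple_def)
  interpret covariance_cocycle e T R
  proof
    fix r t :: real and a assume t: "t \<ge> 0"
    show "covariance_operator (R t)"
      using LK[OF t] by (simp add: covariance_operator_def nuclear_operator_def)
    show "\<exists>C. trace_le (R t) C" by (rule trace_le_if_nuclear_operator[OF LK(1)[OF t]])
    assume r: "r \<ge> 0"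
    have "bounded_linear (T t)" using assms(1) t by (simp add: strongly_continuous_semigroup_def)
    then show "R (r + t) a \<bullet> a = R r (adjoint (T t) a) \<bullet> adjoint (T t) a + R t a \<bullet> a"
      by (intro SC_semigroup_gaussian_cocycle[OF assms r t] adjoint_works)
  qed (rule assms(1))
  from skew_density_exists obtain U where
    U: "\<forall>s>0. covariance_operator (U s) \<and> (\<exists>C. trace_le (U s) C)"
    and skew: "\<forall>s>0. \<forall>t>0. U (s + t) = T t \<circ> U s \<circ> adjoint (T t)"
    and density: "\<forall>t>0. \<forall>a. set_integrable lborel {0<..t} (\<lambda>s. U s a \<bullet> a) \<and>
          R t a \<bullet> a = (LINT s:{0<..t}|lborel. U s a \<bullet> a)"
    and trace: "\<forall>t>0. set_integrable lborel {0<..t} (\<lambda>s. \<Sum>m. U s (e m) \<bullet> e m)"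
    by (elim exE conjE)
  have U_pos: "U s a \<bullet> a \<ge> 0" if "s > 0" for s a
    using U that by (auto intro: covariance_operatorD(3))
  have operator_trace_U: "operator_trace (U s) = (\<Sum>m. U s (e m) \<bullet> e m)" if s: "s > 0" for s
    unfolding operator_trace_def
  proof (rule infsum_e[rule_format])
    obtain C where C: "trace_le (U s) C" using U s by blast
    show "summable (\<lambda>n. U s (e n) \<bullet> e n)"
      using C U_pos[OF s]
      by (intro summableI_nonneg_bounded) (auto simp: trace_le_def)
  qed (use U_pos[OF s] in auto)
  show ?thesis
  proof (intro exI[of _ U] conjI allI impI)
    show "nuclear_operator (U s)" if "s > 0" for s
      using U that nuclear_operator_if_trace_le by blast
    show "U (s + t) = T t \<circ> U s \<circ> adjoint (T t)" if "s > 0" "t > 0" for s t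
      using skew that by blast
    fix t :: real assume "t \<ge> 0"
    \<comment> \<open>The densities were obtained for t > 0. At t = 0 the interval is empty and the
      form of R_0 vanishes by \<open>\<phi>_0\<close>.\<close>
    then consider "t = 0" | "t > 0" by linarith
    note cases = this
    show "set_integrable lborel {0<..t} (\<lambda>s. operator_trace (U s))"
    proof (cases rule: cases)
      case 2
      have "set_integrable lborel {0<..t} (\<lambda>s. operator_trace (U s)) \<longleftrightarrow>
          set_integrable lborel {0<..t} (\<lambda>s. \<Sum>m. U s (e m) \<bullet> e m)"
        by (rule set_integrable_cong) (auto simp: operator_trace_U)
      then show ?thesis using trace 2 by simp
    qed (simp add: set_integrable_def)
    fix a
    show "set_integrable lborel {0<..t} (\<lambda>s. U s a \<bullet> a)"
      by (cases rule: cases) (use density in \<open>auto simp: set_integrable_def[of _ "{}"]\<close>)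
    show "R t a \<bullet> a = (LINT s:{0<..t}|lborel. U s a \<bullet> a)"
      by (cases rule: cases)
         (use density \<phi>_0[of a] in \<open>auto simp: \<phi>_def set_lebesgue_integral_def\<close>)
  qed
qed

end
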